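(* Let $\mathcal{K}(x)=e^{-|x|}/2$ and $d>0$. Let $f:\mathbb{R}\to\mathbb{R}$ be smooth and assume there is $a\in(0,1)$ such that $f(0)=f(a)=f(1)=0$, $f<0$ on $(0,a)$, $f>0$ on $(a,1)$, $f'(0)<0$, $f'(1)<0$, $f'(a)>0$ and $\int_0^1 f(u)\,\mathrm{d}u>0$. Let $g(u):=u-\frac{f(u)}{d}$ and assume that there exist $0<\beta<\gamma<1$ such that $g'>0$ on $[0,\beta)\cup(\gamma,1]$, $g'<0$ on $(\beta,\gamma)$ and $g'(\beta)=g'(\gamma)=0$. With $\mathcal{G}_\pm$ as defined in the context, assume that $\mathcal{G}_-(g(\beta))<0$ and $-\mathcal{G}_-(g(\beta))\ge\mathcal{G}_+(1)-\mathcal{G}_+(g(\beta))$. Let $v_c\in(0,g(\beta)]\cap[g(\gamma),1)$ be such that $\mathcal{G}_+(v_c)-\mathcal{G}_-(v_c)=\mathcal{G}_+(1)$, and assume that $g(u_+)<v_c<g(u_-)$. Then for all $\ell>0$ the solution $u_\ell$ of the Cauchy problem $$\partial_t u = d(-u+\mathcal{K}*u)+f(u),\quad t>0,\ x\in\mathbb{R},\qquad u(0,x)=\mathbf{1}_{[-\ell,\ell]}(x),\quad x\in\mathbb{R},$$ satisfies $$\limsup_{t\to+\infty}u_\ell(t,x)\le U(x)\quad\text{uniformly in }x\in\mathbb{R}\setminus\{\pm x_0\},$$ for some discontinuous ground state $U$ with discontinuity points precisely at $\pm x_0$, with $x_0\ge\ell$.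
   Context: $\mathcal{K}*u$ denotes convolution on $\mathbb{R}$ in the space variable. The Cauchy problem has a unique global solution $u_\ell\in\mathscr{C}^1((0,+\infty),L^1(\mathbb{R})\cap L^\infty(\mathbb{R}))\cap\mathscr{C}^0([0,+\infty),L^1(\mathbb{R})\cap L^\infty(\mathbb{R}))$, which is what "the solution" refers to. A ground state is a bounded, even function $U\in L^2(\mathbb{R})$, possibly discontinuous, with $0=d(-U+\mathcal{K}*U)+f(U)$ on $\mathbb{R}$, $U(\pm\infty)=0$ and $U>0$ on $\mathbb{R}$. $g_-^{-1}$ denotes the inverse of $g$ restricted to $[0,\beta]$ (defined on $[0,g(\beta)]$) and $g_+^{-1}$ the inverse of $g$ restricted to $[\gamma,1]$ (defined on $[g(\gamma),1]$). Set $$\mathcal{G}_-(V):=-\tfrac12V^2+\int_0^Vg_-^{-1}(w)\,\mathrm{d}w,\quad V\in[0,g(\beta)],\qquad \mathcal{G}_+(V):=-\tfrac12V^2-\int_V^1g_+^{-1}(w)\,\mathrm{d}w,\quad V\in[g(\gamma),1].$$ $u_+\in(\gamma,1)$ is such that $f'(u_+)=0$ and $f'(u)<0$ for all $u\in(u_+,1]$; $u_-\in(0,\beta)$ is such that $f'(u_-)=0$ and $f'(u)<0$ for all $u\in[0,u_-)$. (They exist because $f'(\beta)=f'(\gamma)=d>0$, $f'(0)<0$ and $f'(1)<0$.) "$\limsup_{t\to+\infty}u_\ell(t,x)\le U(x)$ uniformly in $x\in A$" means: for every $\varepsilon>0$ there is $T>0$ such that $u_\ell(t,x)\le U(x)+\varepsilon$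 for all $t\ge T$ and $x\in A$. *)

theory Defs
  imports "HOL-Analysis.Analysis" "HOL-Probability.Essential_Supremum"
begin

definition smooth :: "(real \<Rightarrow> real) \<Rightarrow> bool" where
  "smooth f \<longleftrightarrow> (\<forall>n x. ((deriv ^^ n) f) differentiable (at x))"

definition kernel :: "real \<Rightarrow> real" where
  "kernel x = exp (- \<bar>x\<bar>) / 2"

definition conv :: "(real \<Rightarrow> real) \<Rightarrow> (real \<Rightarrow> real) \<Rightarrow> real \<Rightarrow> real" where
  "conv k v x = (LINT y|lebesgue. k (x - y) * v y)"

definition L1_Linf :: "(real \<Rightarrow> real) set" where
  "L1_Linf = {v. integrable lebesgue v \<and> (\<exists>C. AE x in lebesgue. \<bar>v x\<bar> \<le> C)}"

definition norm_L1_Linf :: "(real \<Rightarrow> real) \<Rightarrow> real" where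
  "norm_L1_Linf v =
     (LINT x|lebesgue. \<bar>v x\<bar>) + real_of_ereal (esssup lebesgue (\<lambda>x. ereal \<bar>v x\<bar>))"

definition C0_L1_Linf :: "real set \<Rightarrow> (real \<Rightarrow> real \<Rightarrow> real) \<Rightarrow> bool" where
  "C0_L1_Linf I u \<longleftrightarrow>
     (\<forall>t\<in>I. u t \<in> L1_Linf \<and>
        ((\<lambda>s. norm_L1_Linf (\<lambda>x. u s x - u t x)) \<longlongrightarrow> 0) (at t within I))"

definition C1_L1_Linf :: "real set \<Rightarrow> (real \<Rightarrow> real \<Rightarrow> real) \<Rightarrow> bool" where
  "C1_L1_Linf I u \<longleftrightarrow>
     (\<forall>t\<in>I. u t \<in> L1_Linf) \<and>
     (\<exists>u'. C0_L1_Linf I u' \<and>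
        (\<forall>t\<in>I. ((\<lambda>s. norm_L1_Linf (\<lambda>x. (u s x - u t x) / (s - t) - u' t x)) \<longlongrightarrow> 0)
                  (at t within I)))"

text \<open>
  The solution is a curve \<open>t \<mapsto> u t\<close> in \<open>L\<^sup>1 \<inter> L\<^sup>\<infinity>\<close>, whose elements are only determined
  almost everywhere. Since bounds on it are stated at every point \<open>x\<close>, \<open>u\<close> is taken to be the
  representative for which equation and initial condition hold at every \<open>x\<close>. The pointwise
  continuity clause links the two: continuity in the essential supremum norm does not see
  what happens as \<open>t \<rightarrow> 0\<close> at a single \<open>x\<close>. The values of \<open>u t\<close> for \<open>t < 0\<close> are irrelevant.
\<close>
definition cauchy_solution ::
  "real \<Rightarrow> (real \<Rightarrow> real) \<Rightarrow> real \<Rightarrow> (real \<Rightarrow> real \<Rightarrow> real) \<Rightarrow> bool" where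
  "cauchy_solution d f l u \<longleftrightarrow>
     C1_L1_Linf {0<..} u \<and> C0_L1_Linf {0..} u \<and>
     (\<forall>x. continuous_on {0..} (\<lambda>t. u t x)) \<and>
     (\<forall>t>0. \<forall>x. ((\<lambda>s. u s x) has_real_derivative
                    d * (- u t x + conv kernel (u t) x) + f (u t x)) (at t)) \<and>
     (\<forall>x. u 0 x = indicator {-l..l} x)"

definition ground_state :: "real \<Rightarrow> (real \<Rightarrow> real) \<Rightarrow> (real \<Rightarrow> real) \<Rightarrow> bool" where
  "ground_state d f U \<longleftrightarrow>
     bounded (range U) \<and> (\<forall>x. U (- x) = U x) \<and>
     U \<in> borel_measurable lebesgue \<and> integrable lebesgue (\<lambda>x. (U x)\<^sup>2) \<and>
     (\<forall>x. 0 = d * (- U x + conv kernel U x) + f (U x)) \<and>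
     (U \<longlongrightarrow> 0) at_top \<and> (U \<longlongrightarrow> 0) at_bot \<and>
     (\<forall>x. U x > 0)"

text \<open>
  \<open>G_minus g \<beta>\<close> is meant on \<open>[0, g \<beta>]\<close> and \<open>G_plus g \<gamma>\<close> on \<open>[g \<gamma>, 1]\<close>, for \<open>g\<close> injective on
  \<open>[0, \<beta>]\<close> and on \<open>[\<gamma>, 1]\<close>; elsewhere their values carry no meaning.
\<close>
definition G_minus :: "(real \<Rightarrow> real) \<Rightarrow> real \<Rightarrow> real \<Rightarrow> real" where
  "G_minus g \<beta> V = - V\<^sup>2 / 2 + integral {0..V} (inv_into {0..\<beta>} g)"

definition G_plus :: "(real \<Rightarrow> real) \<Rightarrow> real \<Rightarrow> real \<Rightarrow> real" where
  "G_plus g \<gamma> V = - V\<^sup>2 / 2 - integral {V..1} (inv_into {\<gamma>..1} g)"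

definition limsup_le_uniformly ::
  "(real \<Rightarrow> real \<Rightarrow> real) \<Rightarrow> (real \<Rightarrow> real) \<Rightarrow> real set \<Rightarrow> bool" where
  "limsup_le_uniformly u U A \<longleftrightarrow>
     (\<forall>\<epsilon>>0. \<exists>T>0. \<forall>t\<ge>T. \<forall>x\<in>A. u t x \<le> U x + \<epsilon>)"

end

theory Submission
  imports Defs
begin

text \<open>
  Where \<open>f' \<le> - \<delta>\<close> the two outer branches of \<open>g\<inverse>\<close> are contractions with constant
  \<open>\<theta> = d / (d + \<delta>) < 1\<close>. For given \<open>L\<close> let \<open>H x\<close> be the upper branch if \<open>\<bar>x\<bar> \<le> L\<close> and the lower one
  otherwise; Banach's theorem solves \<open>V = K * H(\<cdot>, V)\<close>, and \<open>U = H(\<cdot>, V)\<close> is the candidate ground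
  state. The values \<open>1 - V\<close> and \<open>V\<close> decay exponentially away from \<open>\<plusminus>L\<close> on either side, and the
  first integrals of \<open>V'' = V - U\<close> on the two sides force \<open>V L \<rightarrow> v_c\<close> as \<open>L \<rightarrow> \<infinity>\<close>, so that for large
  \<open>L\<close> the clipping of the branches is inactive.

  As \<open>U\<close> takes values where \<open>f' \<le> - \<delta>\<close> only, \<open>U + q * exp (- \<delta> * t)\<close> is a supersolution for small
  \<open>q\<close>, and it lies above the initial value as soon as \<open>1 - U \<le> q\<close> on \<open>[-l, l]\<close>, that is, for large \<open>L\<close>.
\<close>

section \<open>Convolution with the kernel\<close>

text \<open>Three values of \<open>\<kappa>\<close> occur later: \<open>0\<close> yields total mass
  one, \<open>1 - \<theta>\<close> the factor \<open>1 / \<theta>\<close> of the decay estimate, and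
  \<open>\<theta>\<close> an integrable majorant for the square of the profile.\<close>

lemma has_bochner_integral_kernel_weight:
  assumes "\<kappa> < 1"
  shows "has_bochner_integral lebesgue (\<lambda>y. kernel (x - y) * exp (\<kappa> * \<bar>x - y\<bar>)) (1 / (1 - \<kappa>))"
proof -
  let ?e = "\<lambda>z::real. exp (- (1 - \<kappa>) * z)" and ?w = "\<lambda>z. exp (- (1 - \<kappa>) * \<bar>z\<bar>) / 2"
  define c where "c = 1 / (1 - \<kappa>)"
  have e: "(?e has_integral c) {0..}"
    using has_integral_exp_minus_to_infinity[of "1 - \<kappa>" 0] assms by (simp add: c_def)
  then have "((\<lambda>z. indicator {0..} z * ?e z) has_integral c) UNIV"
    unfolding has_integral_restrict_UNIV[of "{0..}", symmetric]
    by (rule has_integral_eq[rotated]) (auto simp: indicator_def)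
  then have "(\<integral>\<^sup>+z. ennreal (indicator {0..} z * ?e z) \<partial>lborel) = ennreal (c)"
    using assms by (intro nn_integral_has_integral_lborel) (auto simp: c_def)
  then have "has_bochner_integral lborel (\<lambda>z. indicator {0..} z * ?e z) (c)"
    using assms by (intro has_bochner_integral_nn_integral) (auto simp: c_def)
  then have "has_bochner_integral lborel (\<lambda>z. (indicator {0..} z * ?e z) / 2) (c / 2)"
    by (rule has_bochner_integral_divide_zero)
  then have "has_bochner_integral lborel (\<lambda>z. indicator {0..} z *\<^sub>R ?w z) (c / 2)"
    by (rule has_bochner_integral_cong[THEN iffD1, rotated -1]) (auto simp: indicator_def)
  then have "has_bochner_integral lborel ?w (2 *\<^sub>R (c / 2))"
    by (rule has_bochner_integral_even_function) simp
  then have "has_bochner_integral lebesgue ?w (c)"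
    by (simp add: has_bochner_integral_iff integrable_completion integral_completion)
  then have "has_bochner_integral lebesgue (\<lambda>y. ?w (x + (-1) * y)) (c)"
    by (subst (asm) has_bochner_integral_lebesgue_real_affine_iff[where c = "-1" and t = x]) auto
  then show ?thesis
    unfolding c_def
    by (rule has_bochner_integral_cong[THEN iffD1, rotated -1])
       (auto simp: kernel_def algebra_simps simp flip: exp_add)
qed

lemma kernel_pos: "0 < kernel x"
  by (simp add: kernel_def)

lemma kernel_borel [measurable]: "kernel \<in> borel_measurable borel"
  unfolding kernel_def [abs_def] by measurable

lemma kernel_shift_lebesgue: "(\<lambda>y. kernel (x - y)) \<in> borel_measurable lebesgue"
  by (rule measurable_completion) measurable

lemma has_bochner_integral_kernel: "has_bochner_integral lebesgue (\<lambda>y. kernel (x - y)) 1"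
  using has_bochner_integral_kernel_weight[of 0 x] by simp

lemma integrable_kernel_mult:
  assumes "v \<in> borel_measurable lebesgue" "AE y in lebesgue. \<bar>v y\<bar> \<le> C"
  shows "integrable lebesgue (\<lambda>y. kernel (x - y) * v y)"
proof (rule Bochner_Integration.integrable_bound)
  show "integrable lebesgue (\<lambda>y. kernel (x - y) * C)"
    using has_bochner_integral_kernel[of x] by (auto simp: has_bochner_integral_iff)
  show "(\<lambda>y. kernel (x - y) * v y) \<in> borel_measurable lebesgue"
    by (intro borel_measurable_times kernel_shift_lebesgue assms)
  show "AE y in lebesgue. norm (kernel (x - y) * v y) \<le> norm (kernel (x - y) * C)"
    using assms(2) by eventually_elim (auto simp: abs_mult intro!: mult_left_mono)
qed

lemma conv_const: "conv kernel (\<lambda>_. c) x = c"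
  using has_bochner_integral_kernel[of x] by (auto simp: conv_def has_bochner_integral_iff)

text \<open>The majorant \<open>w\<close> may be unbounded as long as it is integrable against the
  kernel; the exponential weights of the decay estimate are of this kind.\<close>

lemma conv_mono_AE:
  assumes "v \<in> borel_measurable lebesgue" "AE y in lebesgue. \<bar>v y\<bar> \<le> C"
    and "integrable lebesgue (\<lambda>y. kernel (x - y) * w y)"
    and "AE y in lebesgue. v y \<le> w y"
  shows "conv kernel v x \<le> conv kernel w x"
  unfolding conv_def
proof (rule integral_mono_AE[OF integrable_kernel_mult[OF assms(1,2)] assms(3)])
  show "AE y in lebesgue. kernel (x - y) * v y \<le> kernel (x - y) * w y"
    using assms(4) by eventually_elim (auto intro!: mult_left_mono less_imp_le[OF kernel_pos])
qed

lemma conv_mono: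
  assumes "v \<in> borel_measurable lebesgue" "AE y in lebesgue. \<bar>v y\<bar> \<le> C"
    and "w \<in> borel_measurable lebesgue" "AE y in lebesgue. \<bar>w y\<bar> \<le> C'"
    and "AE y in lebesgue. v y \<le> w y"
  shows "conv kernel v x \<le> conv kernel w x"
  by (rule conv_mono_AE[OF assms(1,2) integrable_kernel_mult[OF assms(3,4)] assms(5)])

lemma conv_diff:
  assumes "v \<in> borel_measurable lebesgue" "AE y in lebesgue. \<bar>v y\<bar> \<le> C"
    and "w \<in> borel_measurable lebesgue" "AE y in lebesgue. \<bar>w y\<bar> \<le> C'"
  shows "conv kernel (\<lambda>y. v y - w y) x = conv kernel v x - conv kernel w x"
  using integrable_kernel_mult[OF assms(1,2), of x] integrable_kernel_mult[OF assms(3,4), of x]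
  by (simp add: conv_def right_diff_distrib)

lemma conv_add_const:
  assumes "v \<in> borel_measurable lebesgue" "AE y in lebesgue. \<bar>v y\<bar> \<le> C"
  shows "conv kernel (\<lambda>y. v y + c) x = conv kernel v x + c"
  using conv_diff[OF assms, of "\<lambda>_. - c" "\<bar>c\<bar>" x] by (simp add: conv_const)

text \<open>Under translation the kernel itself varies by at most the factor \<open>exp \<bar>x - x'\<bar>\<close>.\<close>

lemma conv_harnack:
  assumes v: "v \<in> borel_measurable lebesgue" and b: "\<And>y. 0 \<le> v y" "\<And>y. v y \<le> 1"
  shows "exp (- \<bar>x - x'\<bar>) * conv kernel v x \<le> conv kernel v x'"
proof -
  have ae: "AE y in lebesgue. \<bar>v y\<bar> \<le> 1"
    using b by (auto simp: abs_le_iff intro: order_trans)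
  have "exp (- \<bar>x - x'\<bar>) * conv kernel v x = (LINT y|lebesgue. exp (- \<bar>x - x'\<bar>) * (kernel (x - y) * v y))"
    by (simp add: conv_def)
  also have "\<dots> \<le> conv kernel v x'"
    unfolding conv_def
  proof (rule integral_mono)
    fix y
    have "exp (- \<bar>x - x'\<bar>) * kernel (x - y) \<le> kernel (x' - y)"
      by (auto simp: kernel_def simp flip: exp_add)
    then show "exp (- \<bar>x - x'\<bar>) * (kernel (x - y) * v y) \<le> kernel (x' - y) * v y"
      using b(1)[of y] by (simp add: mult.assoc[symmetric] mult_right_mono)
  qed (auto intro!: integrable_kernel_mult[OF v ae])
  finally show ?thesis .
qed

text \<open>By the Harnack bound, a convolution with values in [0, 1] drops by at most
  \<open>1 - exp (- \<bar>x - x'\<bar>)\<close> from \<open>x\<close> to \<open>x'\<close>.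
  Continuity of \<open>v\<close> does not enter, so the jumps of a profile are harmless.\<close>

lemma conv_lipschitz:
  assumes v: "v \<in> borel_measurable lebesgue" and b: "\<And>y. 0 \<le> v y" "\<And>y. v y \<le> 1"
  shows "\<bar>conv kernel v x - conv kernel v x'\<bar> \<le> \<bar>x - x'\<bar>"
proof -
  have ae: "AE y in lebesgue. \<bar>v y\<bar> \<le> 1"
    using b by (auto simp: abs_le_iff intro: order_trans)
  have *: "conv kernel v x - conv kernel v x' \<le> \<bar>x - x'\<bar>" for x x'
  proof -
    have "conv kernel v x \<le> 1"
      using conv_mono[OF v ae, of "\<lambda>_. 1" 1 x] b by (simp add: conv_const)
    moreover have "0 \<le> conv kernel v x"
      using conv_mono[OF _ _ v ae, of "\<lambda>_. 0" 1 x] b by (simp add: conv_const)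
    ultimately have "(1 - exp (- \<bar>x - x'\<bar>)) * conv kernel v x \<le> 1 - exp (- \<bar>x - x'\<bar>)"
      by (intro mult_left_le) auto
    also have "\<dots> \<le> \<bar>x - x'\<bar>"
      using exp_ge_add_one_self[of "- \<bar>x - x'\<bar>"] by simp
    finally show ?thesis using conv_harnack[OF v b, of x x'] by (simp add: algebra_simps)
  qed
  show ?thesis using *[of x x'] *[of x' x] by (simp add: abs_le_iff)
qed

lemma conv_reflect: "conv kernel v (- x) = conv kernel (\<lambda>y. v (- y)) x"
proof -
  have "conv kernel v (- x) = (LINT y|lebesgue. kernel (- x - (0 + (-1) * y)) * v (0 + (-1) * y))"
    unfolding conv_def by (subst lebesgue_integral_real_affine[of "-1" _ 0]) simp_all
  also have "\<dots> = conv kernel (\<lambda>y. v (- y)) x"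
    unfolding conv_def by (intro Bochner_Integration.integral_cong) (auto simp: kernel_def abs_minus_commute)
  finally show ?thesis .
qed

text \<open>The bound \<open>exp (- (1 - \<theta>) * D) / \<theta> + \<theta> ^ n\<close> improves itself, because the weight
  \<open>exp ((1 - \<theta>) * \<bar>z\<bar>)\<close> has kernel average \<open>1 / \<theta>\<close>.\<close>

lemma conv_exponential_decay:
  assumes \<theta>: "0 < \<theta>" "\<theta> < 1"
    and D: "\<And>x y. \<bar>D x - D y\<bar> \<le> \<bar>x - y\<bar>"
    and P: "P \<in> borel_measurable lebesgue" "\<And>y. \<bar>P y\<bar> \<le> C"
    and W: "\<And>x. W x \<le> 1" "\<And>x. W x \<le> conv kernel P x"
    and PW: "\<And>y. P y \<le> \<theta> * W y \<or> (D y \<le> 0 \<and> P y \<le> 1)"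
  shows "W x \<le> exp (- (1 - \<theta>) * D x) / \<theta>"
proof -
  let ?\<kappa> = "1 - \<theta>"
  have step: "W x \<le> exp (- ?\<kappa> * D x) / \<theta> + \<theta> ^ n" for x n
  proof (induction n arbitrary: x)
    case 0
    show ?case using W(1)[of x] \<theta> by (auto intro: order_trans[of _ 1])
  next
    case (Suc n)
    have *: "P y \<le> exp (- ?\<kappa> * D x) * exp (?\<kappa> * \<bar>x - y\<bar>) + \<theta> ^ Suc n" for y
    proof -
      have "P y \<le> exp (- ?\<kappa> * D y) + \<theta> ^ Suc n"
      proof (cases "P y \<le> \<theta> * W y")
        case True
        have "\<theta> * W y \<le> \<theta> * (exp (- ?\<kappa> * D y) / \<theta> + \<theta> ^ n)"
          using Suc \<theta> by (intro mult_left_mono) auto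
        with True show ?thesis using \<theta> by (simp add: distrib_left)
      next
        case False
        then have "D y \<le> 0" "P y \<le> 1" using PW[of y] by auto
        moreover from this have "0 \<le> - ?\<kappa> * D y" using \<theta> by (intro mult_nonpos_nonpos) auto
        then have "1 \<le> exp (- ?\<kappa> * D y)" by simp
        moreover have "0 \<le> \<theta> ^ Suc n" using \<theta> by simp
        ultimately show ?thesis by linarith
      qed
      \<comment> \<open>As \<open>D\<close> is 1-Lipschitz, moving the weight from \<open>y\<close>
        to \<open>x\<close> costs at most the factor
        \<open>exp (?\<kappa> * \<bar>x - y\<bar>)\<close>, whose kernel average is
        \<open>1 / \<theta>\<close>.\<close>
      moreover have "?\<kappa> * (D x - D y) \<le> ?\<kappa> * \<bar>x - y\<bar>"
        using D[of x y] \<theta> by (intro mult_left_mono) auto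
      then have "exp (- ?\<kappa> * D y) \<le> exp (- ?\<kappa> * D x) * exp (?\<kappa> * \<bar>x - y\<bar>)"
        by (simp add: algebra_simps flip: exp_add)
      ultimately show ?thesis by linarith
    qed
    have k: "has_bochner_integral lebesgue (\<lambda>y. kernel (x - y) *
        (exp (- ?\<kappa> * D x) * exp (?\<kappa> * \<bar>x - y\<bar>) + \<theta> ^ Suc n)) (exp (- ?\<kappa> * D x) * (1 / \<theta>) + 1 * \<theta> ^ Suc n)"
    proof (rule has_bochner_integral_cong[THEN iffD1, rotated -1])
      show "has_bochner_integral lebesgue (\<lambda>y. exp (- ?\<kappa> * D x) * (kernel (x - y) * exp (?\<kappa> * \<bar>x - y\<bar>))
        + kernel (x - y) * \<theta> ^ Suc n) (exp (- ?\<kappa> * D x) * (1 / \<theta>) + 1 * \<theta> ^ Suc n)"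
        using has_bochner_integral_kernel_weight[of ?\<kappa> x] \<theta>
        by (intro has_bochner_integral_add has_bochner_integral_mult_right
              has_bochner_integral_mult_left has_bochner_integral_kernel) auto
    qed (auto simp: algebra_simps)
    have "W x \<le> conv kernel P x" by (rule W)
    also have "\<dots> \<le> conv kernel (\<lambda>y. exp (- ?\<kappa> * D x) * exp (?\<kappa> * \<bar>x - y\<bar>) + \<theta> ^ Suc n) x"
      using k * by (intro conv_mono_AE[OF P(1), of C]) (auto simp: P has_bochner_integral_iff)
    also have "\<dots> = exp (- ?\<kappa> * D x) / \<theta> + \<theta> ^ Suc n"
      using k by (auto simp: conv_def has_bochner_integral_iff)
    finally show ?case .
  qed
  have "(\<lambda>n. exp (- ?\<kappa> * D x) / \<theta> + \<theta> ^ n) \<longlonglongrightarrow> exp (- ?\<kappa> * D x) / \<theta> + 0"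
    using \<theta> by (intro tendsto_intros LIMSEQ_power_zero) auto
  then show ?thesis
    using step by (intro LIMSEQ_le_const[of _ _ "W x"]) auto
qed

section \<open>Derivatives of the convolution\<close>

lemma conv_lborel:
  assumes [measurable]: "v \<in> borel_measurable borel"
  shows "conv kernel v x = (LINT y|lborel. kernel (x - y) * v y)"
  unfolding conv_def by (rule integral_completion) measurable

text \<open>This is the derivative of \<open>conv kernel v\<close>: the kernel is split at
  \<open>y = x\<close> into its two exponential halves, differentiating the outer factors flips one
  sign, and the boundary terms cancel.\<close>

definition dconv :: "(real \<Rightarrow> real) \<Rightarrow> real \<Rightarrow> real" where
  "dconv v x = (exp x * (LINT y:{x<..}|lborel. exp (- y) * v y)
     - exp (- x) * (LINT y:{..x}|lborel. exp y * v y)) / 2"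

text \<open>The half-open interval leaves the value of \<open>f\<close> at \<open>a\<close> free: a
  profile agrees with a continuous function only to the right of its jump, and a single point has
  measure zero.\<close>

lemma set_integral_eq_integral_continuous:
  fixes a b x :: real and \<phi> f :: "real \<Rightarrow> real"
  assumes \<phi>: "continuous_on {a..b} \<phi>" and x: "x \<in> {a..b}" and eq: "\<And>y. y \<in> {a<..b} \<Longrightarrow> f y = \<phi> y"
    and [measurable]: "f \<in> borel_measurable borel"
  shows "(LINT y:{a<..x}|lborel. f y) = integral {a..x} \<phi>"
    and "set_integrable lborel {a<..x} f"
proof -
  have c: "continuous_on {a..x} \<phi>" by (rule continuous_on_subset[OF \<phi>]) (use x in auto)
  have i: "set_integrable lborel {a..x} \<phi>" by (rule borel_integrable_atLeastAtMost'[OF c])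
  have m: "(\<lambda>y. indicator {a..x} y *\<^sub>R \<phi> y) \<in> borel_measurable lborel"
    using i unfolding set_integrable_def by auto
  have ae: "AE y in lborel. indicator {a..x} y *\<^sub>R \<phi> y = indicator {a<..x} y *\<^sub>R f y"
    using AE_lborel_singleton[of a] x eq by (auto simp: indicator_def)
  show "(LINT y:{a<..x}|lborel. f y) = integral {a..x} \<phi>"
    unfolding set_borel_integral_eq_integral(2)[OF i, symmetric] set_lebesgue_integral_def
    by (rule integral_cong_AE) (use m ae in auto)
  show "set_integrable lborel {a<..x} f"
    using i unfolding set_integrable_def
    by (rule integrable_cong_AE[THEN iffD1, rotated -1]) (use m ae in auto)
qed

context
  fixes v :: "real \<Rightarrow> real"
  assumes v_borel [measurable]: "v \<in> borel_measurable borel"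
    and v_range: "\<And>y. 0 \<le> v y" "\<And>y. v y \<le> 1"
begin

lemma integrable_kernel_lborel: "integrable lborel (\<lambda>y. kernel (x - y) * v y)"
proof -
  have "integrable lebesgue (\<lambda>y. kernel (x - y) * v y)"
    using v_range by (intro integrable_kernel_mult[of _ 1] measurable_completion) (auto simp: abs_le_iff intro: order_trans)
  then show ?thesis by (subst (asm) integrable_completion) auto
qed

lemma set_integrable_left: "set_integrable lborel {..x} (\<lambda>y. exp y * v y)"
proof -
  have "integrable lborel (\<lambda>y. 2 * exp x * (indicator {..x} y *\<^sub>R (kernel (x - y) * v y)))"
    by (intro integrable_mult_right integrable_mult_indicator integrable_kernel_lborel) auto
  then show ?thesis
    unfolding set_integrable_def
    by (rule Bochner_Integration.integrable_cong[THEN iffD1, rotated -1])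
       (auto simp: indicator_def kernel_def exp_diff)
qed

lemma set_integrable_right: "set_integrable lborel {x<..} (\<lambda>y. exp (- y) * v y)"
proof -
  have "integrable lborel (\<lambda>y. 2 * exp (- x) * (indicator {x<..} y *\<^sub>R (kernel (x - y) * v y)))"
    by (intro integrable_mult_right integrable_mult_indicator integrable_kernel_lborel) auto
  then show ?thesis
    unfolding set_integrable_def
    by (rule Bochner_Integration.integrable_cong[THEN iffD1, rotated -1])
       (auto simp: indicator_def kernel_def simp flip: exp_add)
qed

lemma conv_split:
  "conv kernel v x = (exp x * (LINT y:{x<..}|lborel. exp (- y) * v y)
     + exp (- x) * (LINT y:{..x}|lborel. exp y * v y)) / 2"
proof -
  have "conv kernel v x = (LINT y|lborel. exp x / 2 * (indicator {x<..} y *\<^sub>R (exp (- y) * v y))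
      + exp (- x) / 2 * (indicator {..x} y *\<^sub>R (exp y * v y)))"
    unfolding conv_lborel[OF v_borel]
    by (rule Bochner_Integration.integral_cong) (auto simp: indicator_def kernel_def simp flip: exp_add)
  also have "\<dots> = exp x / 2 * (LINT y:{x<..}|lborel. exp (- y) * v y)
      + exp (- x) / 2 * (LINT y:{..x}|lborel. exp y * v y)"
    using set_integrable_left[of x] set_integrable_right[of x]
    unfolding set_lebesgue_integral_def set_integrable_def
    by (subst Bochner_Integration.integral_add) (auto intro!: integrable_mult_right)
  finally show ?thesis by (simp add: field_simps)
qed

text \<open>Both one-sided integrals are nonnegative; \<open>conv\<close> is half the sum and
  \<open>dconv\<close> half the difference of the same two terms.\<close>

lemma abs_dconv_le: "\<bar>dconv v x\<bar> \<le> conv kernel v x"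
proof -
  have "0 \<le> (LINT y:{x<..}|lborel. exp (- y) * v y)" "0 \<le> (LINT y:{..x}|lborel. exp y * v y)"
    unfolding set_lebesgue_integral_def using v_range
    by (auto intro!: Bochner_Integration.integral_nonneg)
  then have "0 \<le> exp x * (LINT y:{x<..}|lborel. exp (- y) * v y)"
    "0 \<le> exp (- x) * (LINT y:{..x}|lborel. exp y * v y)" by simp_all
  then show ?thesis unfolding conv_split dconv_def by (simp add: abs_le_iff)
qed

lemma dconv_even_0:
  assumes "\<And>y. v (- y) = v y"
  shows "dconv v 0 = 0"
proof -
  have "(LINT y:{0<..}|lborel. exp (- y) * v y) = (LINT y:{..<0}|lborel. exp y * v y)"
    unfolding set_lebesgue_integral_def
    by (subst lborel_integral_real_affine[of "-1" _ 0])
       (auto simp: assms indicator_def intro!: Bochner_Integration.integral_cong)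
  also have "\<dots> = (LINT y:{..0}|lborel. exp y * v y)"
    unfolding set_lebesgue_integral_def
    by (rule integral_cong_AE) (use AE_lborel_singleton[of 0] in \<open>auto simp: indicator_def\<close>)
  finally show ?thesis by (simp add: dconv_def)
qed

text \<open>In classical terms, w = K * v solves w'' = w - v wherever v is continuous. Agreement of
  \<open>v\<close> with \<open>\<phi>\<close> is required on \<open>{a<..b}\<close> only, so a jump
  at \<open>a\<close> still admits one-sided derivatives there. In the product rule the boundary
  terms cancel for the first derivative and add up to \<open>- \<phi> x\<close> for the
  second.\<close>

lemma conv_has_derivatives:
  assumes \<phi>: "continuous_on {a..b} \<phi>" and eq: "\<And>y. y \<in> {a<..b} \<Longrightarrow> v y = \<phi> y" and x: "x \<in> {a..b}"
  shows "(conv kernel v has_real_derivative dconv v x) (at x within {a..b})"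
    and "(dconv v has_real_derivative conv kernel v x - \<phi> x) (at x within {a..b})"
proof -
  define A B where "A = (\<lambda>x. LINT y:{..x}|lborel. exp y * v y)"
    and "B = (\<lambda>x. LINT y:{x<..}|lborel. exp (- y) * v y)"
  have cA: "continuous_on {a..b} (\<lambda>y. exp y * \<phi> y)" and cB: "continuous_on {a..b} (\<lambda>y. exp (- y) * \<phi> y)"
    by (intro continuous_intros \<phi>)+
  have A: "A z = A a + integral {a..z} (\<lambda>y. exp y * \<phi> y)" if z: "z \<in> {a..b}" for z
  proof -
    have e: "{..z} = {..a} \<union> {a<..z}" using z by auto
    have "A z = A a + (LINT y:{a<..z}|lborel. exp y * v y)"
      unfolding A_def e
      by (rule set_integral_Un) (use set_integrable_left set_integral_eq_integral_continuous(2)[OF cA z] eq in auto)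
    then show ?thesis
      using set_integral_eq_integral_continuous(1)[OF cA z, of "\<lambda>y. exp y * v y"] eq by auto
  qed
  have B: "B z = B a - integral {a..z} (\<lambda>y. exp (- y) * \<phi> y)" if z: "z \<in> {a..b}" for z
  proof -
    have e: "{a<..} = {a<..z} \<union> {z<..}" using z by auto
    have "B a = (LINT y:{a<..z}|lborel. exp (- y) * v y) + B z"
      unfolding B_def e
      by (rule set_integral_Un) (use set_integrable_right set_integral_eq_integral_continuous(2)[OF cB z] eq in auto)
    then show ?thesis
      using set_integral_eq_integral_continuous(1)[OF cB z, of "\<lambda>y. exp (- y) * v y"] eq by auto
  qed
  have "((\<lambda>z. A a + integral {a..z} (\<lambda>y. exp y * \<phi> y)) has_real_derivative exp x * \<phi> x) (at x within {a..b})"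
    by (auto intro!: derivative_eq_intros integral_has_real_derivative[OF cA x])
  then have dA: "(A has_real_derivative exp x * \<phi> x) (at x within {a..b})"
    by (rule has_field_derivative_transform_within[OF _ zero_less_one x]) (erule A[symmetric])
  have "((\<lambda>z. B a - integral {a..z} (\<lambda>y. exp (- y) * \<phi> y)) has_real_derivative - exp (- x) * \<phi> x) (at x within {a..b})"
    by (auto intro!: derivative_eq_intros integral_has_real_derivative[OF cB x])
  then have dB: "(B has_real_derivative - exp (- x) * \<phi> x) (at x within {a..b})"
    by (rule has_field_derivative_transform_within[OF _ zero_less_one x]) (erule B[symmetric])
  have conv: "conv kernel v = (\<lambda>z. (exp z * B z + exp (- z) * A z) / 2)"
    and dconv: "dconv v = (\<lambda>z. (exp z * B z - exp (- z) * A z) / 2)"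
    by (auto simp: conv_split dconv_def A_def B_def)
  have [simp]: "exp x * (exp (- x) * c) = c" "exp (- x) * (exp x * c) = c" for c :: real
    by (simp_all add: mult.assoc[symmetric] flip: exp_add)
  show "(conv kernel v has_real_derivative dconv v x) (at x within {a..b})"
    unfolding conv dconv
    by (auto intro!: derivative_eq_intros dA dB simp: algebra_simps) (simp add: diff_divide_distrib)
  show "(dconv v has_real_derivative conv kernel v x - \<phi> x) (at x within {a..b})"
    unfolding conv dconv
    by (auto intro!: derivative_eq_intros dA dB simp: algebra_simps exp_minus_inverse add_divide_distrib diff_divide_distrib)
qed

end

section \<open>Two-branch profiles\<close>

text \<open>\<open>hm\<close> and \<open>hp\<close> stand for the lower and upper inverse branches of \<open>g\<close>, made total
  contractions by clipping their argument to the range where \<open>g\<close> is expanding.\<close>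

locale branches =
  fixes \<theta> L :: real and hm hp :: "real \<Rightarrow> real"
  assumes \<theta>: "0 < \<theta>" "\<theta> < 1" and L: "0 < L"
    and hm_lip: "\<And>v w. \<bar>hm v - hm w\<bar> \<le> \<theta> * \<bar>v - w\<bar>"
    and hp_lip: "\<And>v w. \<bar>hp v - hp w\<bar> \<le> \<theta> * \<bar>v - w\<bar>"
    and hm_range: "\<And>v. 0 \<le> hm v" "\<And>v. hm v \<le> 1"
    and hp_range: "\<And>v. 0 \<le> hp v" "\<And>v. hp v \<le> 1"
    and hm_0: "hm 0 = 0" and hp_1: "hp 1 = 1"
begin

definition H :: "real \<Rightarrow> real \<Rightarrow> real" where
  "H x v = (if \<bar>x\<bar> \<le> L then hp v else hm v)"

lemma H_lip: "\<bar>H x v - H x w\<bar> \<le> \<theta> * \<bar>v - w\<bar>"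
  using hm_lip hp_lip by (simp add: H_def)

lemma H_range: "0 \<le> H x v" "H x v \<le> 1"
  using hm_range hp_range by (simp_all add: H_def)

lemma hm_cont: "continuous_on A hm" and hp_cont: "continuous_on A hp"
  using \<theta> hm_lip hp_lip
  by (auto intro!: lipschitz_on_continuous_on[of \<theta>] lipschitz_onI simp: dist_real_def)

lemma hm_le: "0 \<le> v \<Longrightarrow> hm v \<le> \<theta> * v"
  using hm_lip[of v 0] hm_0 by simp

lemma hp_ge: "v \<le> 1 \<Longrightarrow> 1 - hp v \<le> \<theta> * (1 - v)"
  using hp_lip[of 1 v] hp_1 by simp

lemma H_borel: "continuous_on UNIV V \<Longrightarrow> (\<lambda>y. H y (V y)) \<in> borel_measurable borel"
proof -
  assume V: "continuous_on UNIV V"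
  have [measurable]: "(\<lambda>y. hp (V y)) \<in> borel_measurable borel" "(\<lambda>y. hm (V y)) \<in> borel_measurable borel"
    by (auto intro!: borel_measurable_continuous_onI continuous_on_compose2[OF hp_cont V] continuous_on_compose2[OF hm_cont V])
  show ?thesis unfolding H_def by measurable
qed

lemma H_lebesgue: "continuous_on UNIV V \<Longrightarrow> (\<lambda>y. H y (V y)) \<in> borel_measurable lebesgue"
  by (intro measurable_completion) (simp add: H_borel)

lemma H_AE: "AE y in lebesgue. \<bar>H y (V y)\<bar> \<le> 1"
  using H_range by (auto simp: abs_le_iff intro: order_trans)

lemma conv_H_range:
  assumes "continuous_on UNIV V"
  shows "0 \<le> conv kernel (\<lambda>y. H y (V y)) x" "conv kernel (\<lambda>y. H y (V y)) x \<le> 1"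
  using conv_mono[OF H_lebesgue[OF assms] H_AE, of "\<lambda>_. 1" 1 x]
    conv_mono[OF _ _ H_lebesgue[OF assms] H_AE, of "\<lambda>_. 0" 1 x] H_range
  by (auto simp: conv_const)

text \<open>The iteration acts on V and not on U: V is continuous, so the complete space of bounded
  continuous functions is available, whereas U jumps.\<close>

definition T :: "(real \<Rightarrow>\<^sub>C real) \<Rightarrow> (real \<Rightarrow>\<^sub>C real)" where
  "T V = Bcontfun (conv kernel (\<lambda>y. H y (apply_bcontfun V y)))"

lemma T_apply: "apply_bcontfun (T V) x = conv kernel (\<lambda>y. H y (apply_bcontfun V y)) x"
proof -
  have "conv kernel (\<lambda>y. H y (apply_bcontfun V y)) \<in> bcontfun"
  proof (rule bcontfun_normI)
    show "continuous_on UNIV (conv kernel (\<lambda>y. H y (apply_bcontfun V y)))"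
      using conv_lipschitz[OF H_lebesgue] H_range
      by (intro lipschitz_on_continuous_on[of 1] lipschitz_onI) (auto simp: dist_real_def)
    show "norm (conv kernel (\<lambda>y. H y (apply_bcontfun V y)) x) \<le> 1" for x
      using conv_H_range[of "apply_bcontfun V" x] by auto
  qed
  then show ?thesis by (simp add: T_def Bcontfun_inverse)
qed

text \<open>Each \<open>H x\<close> is a contraction with constant \<open>\<theta>\<close>, and
  averaging against a kernel of mass one does not increase the sup distance.\<close>

lemma T_unique_fixpoint: "\<exists>!V. T V = V"
proof (rule banach_fix_type[of \<theta>])
  show "\<forall>V W. dist (T V) (T W) \<le> \<theta> * dist V W"
  proof (intro allI dist_bound)
    fix V W :: "real \<Rightarrow>\<^sub>C real" and x
    \<comment> \<open>One-sided for arbitrary \<open>V\<close> and \<open>W\<close>; exchanging the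
      two gives the absolute value.\<close>
    have *: "conv kernel (\<lambda>y. H y (apply_bcontfun V y)) x \<le>
        conv kernel (\<lambda>y. H y (apply_bcontfun W y)) x + \<theta> * dist V W" for V W
    proof -
      let ?c = "\<theta> * dist V W"
      have c: "0 \<le> ?c" using \<theta> by simp
      have b: "\<bar>H y (apply_bcontfun W y) + ?c\<bar> \<le> 1 + ?c" for y
        using H_range[of y "apply_bcontfun W y"] c by (simp add: abs_le_iff)
      have "H y (apply_bcontfun V y) \<le> H y (apply_bcontfun W y) + ?c" for y
      proof -
        have "\<bar>H y (apply_bcontfun V y) - H y (apply_bcontfun W y)\<bar> \<le> \<theta> * \<bar>apply_bcontfun V y - apply_bcontfun W y\<bar>"
          by (rule H_lip)
        also have "\<dots> \<le> ?c"
          using dist_bounded[of V y W] \<theta> by (intro mult_left_mono) (auto simp: dist_real_def)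
        finally show ?thesis by simp
      qed
      then have "conv kernel (\<lambda>y. H y (apply_bcontfun V y)) x \<le>
          conv kernel (\<lambda>y. H y (apply_bcontfun W y) + ?c) x"
        by (intro conv_mono[OF H_lebesgue H_AE, of _ _ "1 + ?c"]) (auto intro!: borel_measurable_add H_lebesgue b)
      then show ?thesis by (simp add: conv_add_const[OF H_lebesgue H_AE])
    qed
    show "dist (apply_bcontfun (T V) x) (apply_bcontfun (T W) x) \<le> \<theta> * dist V W"
      using *[of V W] *[of W V] by (simp add: T_apply dist_real_def dist_commute abs_le_iff)
  qed
qed (use \<theta> in auto)

text \<open>Evenness comes from uniqueness: \<open>H\<close> is even in \<open>x\<close>, so the
  reflection \<open>W\<close> of the fixed point is again a fixed point.\<close>

lemma ex_profile:
  "\<exists>V. continuous_on UNIV V \<and> (\<forall>x. V (- x) = V x) \<and> V = conv kernel (\<lambda>y. H y (V y))"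
proof -
  obtain V where V: "T V = V" and uniq: "\<And>W. T W = W \<Longrightarrow> W = V"
    using T_unique_fixpoint by auto
  have eq: "apply_bcontfun V x = conv kernel (\<lambda>y. H y (apply_bcontfun V y)) x" for x
    by (subst V[symmetric]) (rule T_apply)
  define W where "W = Bcontfun (\<lambda>x. apply_bcontfun V (- x))"
  have W: "apply_bcontfun W x = apply_bcontfun V (- x)" for x
  proof -
    have "(\<lambda>x. apply_bcontfun V (- x)) \<in> bcontfun"
    proof (rule bcontfun_normI)
      show "continuous_on UNIV (\<lambda>x. apply_bcontfun V (- x))"
        by (rule continuous_on_compose2[of UNIV "apply_bcontfun V"]) (auto intro!: continuous_intros)
      show "norm (apply_bcontfun V (- x)) \<le> norm V" for x by (rule norm_bounded)
    qed
    then show ?thesis by (simp add: W_def Bcontfun_inverse)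
  qed
  have "T W = W"
  proof (rule bcontfun_eqI)
    show "apply_bcontfun (T W) x = apply_bcontfun W x" for x
      unfolding T_apply W eq[of "- x"] conv_reflect by (simp add: H_def)
  qed
  then have "W = V" by (rule uniq)
  then have even: "apply_bcontfun V (- x) = apply_bcontfun V x" for x using W[of x] by simp
  show ?thesis
    by (intro exI[of _ "apply_bcontfun V"] conjI allI continuous_on_apply_bcontfun even ext eq)
qed

end

section \<open>Potentials and conservation of energy\<close>

lemma nonpos_deriv_imp_ge:
  fixes f :: "real \<Rightarrow> real"
  assumes "a \<le> b" and d: "\<And>x. x \<in> {a..b} \<Longrightarrow> (f has_real_derivative f' x) (at x within {a..b})"
    and "\<And>x. x \<in> {a..b} \<Longrightarrow> f' x \<le> 0"
  shows "f b \<le> f a"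
proof (rule DERIV_nonpos_imp_decreasing_open[OF \<open>a \<le> b\<close>])
  show "continuous_on {a..b} f" using d by (rule DERIV_continuous_on)
  show "\<exists>y. DERIV f x :> y \<and> y \<le> 0" if "a < x" "x < b" for x
    using d[of x] assms(3)[of x] that by (auto simp: at_within_Icc_at)
qed

text \<open>Potential energy for V'' = V - h(V). Where clipping is inactive, it is
  \<open>G_minus\<close> for the lower branch and, up to an additive constant, \<open>G_plus\<close>
  for the upper one.\<close>

definition potential :: "(real \<Rightarrow> real) \<Rightarrow> real \<Rightarrow> real" where
  "potential h v = integral {0..v} (\<lambda>w. h w - w)"

lemma potential_deriv:
  assumes "continuous_on {0..1} h" "v \<in> {0..1}"
  shows "(potential h has_real_derivative h v - v) (at v within {0..1})"
  unfolding potential_def [abs_def]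
  by (rule integral_has_real_derivative) (use assms in \<open>auto intro!: continuous_intros\<close>)

lemma potential_lipschitz:
  assumes h: "continuous_on {0..1} h" and r: "\<And>v. 0 \<le> h v" "\<And>v. h v \<le> 1"
    and ab: "0 \<le> a" "a \<le> b" "b \<le> 1"
  shows "\<bar>potential h b - potential h a\<bar> \<le> b - a"
proof -
  have d: "(potential h has_real_derivative h v - v) (at v within {a..b})" if "v \<in> {a..b}" for v
    by (rule DERIV_subset[OF potential_deriv[OF h]]) (use that ab in auto)
  have "potential h b - b \<le> potential h a - a"
  proof (rule nonpos_deriv_imp_ge[OF ab(2)])
    fix v assume v: "v \<in> {a..b}"
    show "((\<lambda>v. potential h v - v) has_real_derivative h v - v - 1) (at v within {a..b})"
      by (auto intro!: derivative_eq_intros d[OF v])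
    show "h v - v - 1 \<le> 0" using r(2)[of v] v ab by auto
  qed
  moreover have "- potential h b - b \<le> - potential h a - a"
  proof (rule nonpos_deriv_imp_ge[OF ab(2)])
    fix v assume v: "v \<in> {a..b}"
    show "((\<lambda>v. - potential h v - v) has_real_derivative - (h v - v) - 1) (at v within {a..b})"
      by (auto intro!: derivative_eq_intros d[OF v])
    show "- (h v - v) - 1 \<le> 0" using r(1)[of v] v ab by auto
  qed
  ultimately show ?thesis by (simp add: abs_le_iff)
qed

text \<open>The derivative of the energy is V' * (V'' + h(V) - V), which vanishes along the
  equation.\<close>

lemma energy_conserved:
  assumes ab: "a \<le> b" and h: "continuous_on {0..1} h" and V: "V ` {a..b} \<subseteq> {0..1}"
    and dV: "\<And>x. x \<in> {a..b} \<Longrightarrow> (V has_real_derivative V' x) (at x within {a..b})"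
    and dV': "\<And>x. x \<in> {a..b} \<Longrightarrow> (V' has_real_derivative V x - h (V x)) (at x within {a..b})"
  shows "(V' b)\<^sup>2 / 2 + potential h (V b) = (V' a)\<^sup>2 / 2 + potential h (V a)"
proof -
  have "((\<lambda>x. (V' x)\<^sup>2 / 2 + potential h (V x)) has_real_derivative 0) (at x within {a..b})" if x: "x \<in> {a..b}" for x
  proof -
    \<comment> \<open>The derivative of \<open>potential h\<close> is known only within
      \<open>{0..1}\<close>, so the chain rule is applied within the image of
      \<open>V\<close>.\<close>
    have "(potential h has_real_derivative h (V x) - V x) (at (V x) within V ` {a..b})"
      using V x by (intro DERIV_subset[OF potential_deriv[OF h] V]) blast
    then have "((\<lambda>x. potential h (V x)) has_real_derivative (h (V x) - V x) * V' x) (at x within {a..b})"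
      using DERIV_image_chain[OF _ dV[OF x]] by (simp add: o_def)
    then show ?thesis
      by (auto intro!: derivative_eq_intros dV'[OF x] simp: algebra_simps) (simp add: diff_divide_distrib)
  qed
  then have "\<exists>c. \<forall>x\<in>{a..b}. (V' x)\<^sup>2 / 2 + potential h (V x) = c"
    by (intro has_field_derivative_zero_constant) auto
  then show ?thesis using ab by auto
qed

section \<open>Decay, monotonicity and energy of the profile\<close>

context branches
begin

context
  fixes V :: "real \<Rightarrow> real"
  assumes V_cont: "continuous_on UNIV V" and V_even: "\<And>x. V (- x) = V x"
    and V_eq: "V = conv kernel (\<lambda>y. H y (V y))"
begin

abbreviation "U \<equiv> \<lambda>y. H y (V y)"

lemma V_range: "0 \<le> V x" "V x \<le> 1"
  using conv_H_range[OF V_cont, of x] V_eq by (metis)+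

text \<open>Outside [-L, L] the lower branch contracts towards \<open>hm 0 = 0\<close>, so the decay
  estimate applies with the signed distance to the core.\<close>

lemma V_tail: "V x \<le> exp (- (1 - \<theta>) * (\<bar>x\<bar> - L)) / \<theta>"
proof (rule conv_exponential_decay[OF \<theta>, where D = "\<lambda>x. \<bar>x\<bar> - L" and P = U and C = 1])
  show "V x \<le> conv kernel U x" for x using V_eq by (metis order_refl)
  show "U y \<le> \<theta> * V y \<or> \<bar>y\<bar> - L \<le> 0 \<and> U y \<le> 1" for y
    using hm_le[OF V_range(1)] H_range by (auto simp: H_def hp_range)
  show "\<bar>U y\<bar> \<le> 1" for y using H_range[of y "V y"] by linarith
  show "\<bar>(\<bar>x\<bar> - L) - (\<bar>y\<bar> - L)\<bar> \<le> \<bar>x - y\<bar>" for x y :: real by linarith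
qed (rule V_range H_lebesgue[OF V_cont])+

text \<open>The mirror image of the tail estimate: inside, the upper branch contracts towards its
  fixed point 1, so \<open>1 - U\<close> decays in the distance measured inwards.\<close>

lemma V_core: "1 - V x \<le> exp (- (1 - \<theta>) * (L - \<bar>x\<bar>)) / \<theta>"
proof (rule conv_exponential_decay[OF \<theta>, where D = "\<lambda>x. L - \<bar>x\<bar>" and P = "\<lambda>y. 1 - U y" and C = 1])
  show "1 - V x \<le> conv kernel (\<lambda>y. 1 - U y) x" for x
    using conv_diff[of "\<lambda>_. 1" 1 U 1 x, OF _ _ H_lebesgue[OF V_cont] H_AE] conv_const[of 1 x]
      fun_cong[OF V_eq, of x] by simp
  show "1 - U y \<le> \<theta> * (1 - V y) \<or> L - \<bar>y\<bar> \<le> 0 \<and> 1 - U y \<le> 1" for y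
    using hp_ge[OF V_range(2)] H_range by (auto simp: H_def hm_range)
  show "\<bar>1 - U y\<bar> \<le> 1" for y using H_range[of y "V y"] by linarith
  show "\<bar>(L - \<bar>x\<bar>) - (L - \<bar>y\<bar>)\<bar> \<le> \<bar>x - y\<bar>" for x y :: real by linarith
  show "1 - V x \<le> 1" for x using V_range(1)[of x] by simp
qed (intro borel_measurable_diff borel_measurable_const H_lebesgue[OF V_cont])

lemma V_derivs:
  assumes "continuous_on UNIV h" "\<And>y. y \<in> {a<..b} \<Longrightarrow> U y = h (V y)" "x \<in> {a..b}"
  shows "(V has_real_derivative dconv U x) (at x within {a..b})"
    and "(dconv U has_real_derivative V x - h (V x)) (at x within {a..b})"
proof -
  have c: "continuous_on {a..b} (\<lambda>y. h (V y))"
    by (rule continuous_on_compose2[OF assms(1)]) (auto intro: continuous_on_subset[OF V_cont])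
  show "(V has_real_derivative dconv U x) (at x within {a..b})"
    using conv_has_derivatives(1)[OF H_borel[OF V_cont] H_range c assms(2,3)] V_eq by simp
  show "(dconv U has_real_derivative V x - h (V x)) (at x within {a..b})"
    using conv_has_derivatives(2)[OF H_borel[OF V_cont] H_range c assms(2,3)] V_eq by simp
qed

lemma V_derivs_inner:
  assumes "0 \<le> a" "b \<le> L" "x \<in> {a..b}"
  shows "(V has_real_derivative dconv U x) (at x within {a..b})"
    and "(dconv U has_real_derivative V x - hp (V x)) (at x within {a..b})"
  by (rule V_derivs; use assms hp_cont in \<open>auto simp: H_def\<close>)+

lemma V_derivs_outer:
  assumes "L \<le> a" "x \<in> {a..b}"
  shows "(V has_real_derivative dconv U x) (at x within {a..b})"
    and "(dconv U has_real_derivative V x - hm (V x)) (at x within {a..b})"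
  by (rule V_derivs; use assms hm_cont L in \<open>auto simp: H_def\<close>)+

lemma dconv_U_0: "dconv U 0 = 0"
  by (rule dconv_even_0[OF H_borel[OF V_cont] H_range]) (simp add: H_def V_even)

lemma abs_dconv_U_le: "\<bar>dconv U x\<bar> \<le> V x"
  using abs_dconv_le[OF H_borel[OF V_cont] H_range, of x] V_eq by simp

lemma V_tendsto_0: "(V \<longlongrightarrow> 0) at_top"
proof (rule tendsto_sandwich[OF _ _ tendsto_const])
  show "((\<lambda>x. exp (- (1 - \<theta>) * (x - L)) / \<theta>) \<longlongrightarrow> 0) at_top"
    using \<theta> by real_asymp
  show "\<forall>\<^sub>F x in at_top. V x \<le> exp (- (1 - \<theta>) * (x - L)) / \<theta>"
    using eventually_ge_at_top[of 0] by eventually_elim (use V_tail in \<open>metis abs_of_nonneg\<close>)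
qed (use V_range in auto)

text \<open>On [0, L] the bound \<open>hp v \<ge> v\<close> makes V concave, and V'(0) = 0 by
  symmetry; hence V is nonincreasing up to \<open>L\<close>.\<close>

lemma V_inner:
  assumes "\<bar>x\<bar> \<le> L"
  shows "V L \<le> V x"
proof -
  have *: "V L \<le> V x" if "0 \<le> x" "x \<le> L" for x
  proof (rule nonpos_deriv_imp_ge[OF \<open>x \<le> L\<close>])
    fix y assume y: "y \<in> {x..L}"
    show "(V has_real_derivative dconv U y) (at y within {x..L})"
      using y that by (intro V_derivs_inner) auto
    have "dconv U y \<le> dconv U 0"
    proof (rule nonpos_deriv_imp_ge[where a = 0 and b = y and f = "dconv U"])
      fix z assume z: "z \<in> {0..y}"
      show "(dconv U has_real_derivative V z - hp (V z)) (at z within {0..y})"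
        using z y that by (intro V_derivs_inner) auto
      have "1 - hp (V z) \<le> 1 * (1 - V z)"
        using hp_ge[OF V_range(2)[of z]] V_range(2)[of z] \<theta>
        by (intro order_trans[OF hp_ge] mult_right_mono) auto
      then show "V z - hp (V z) \<le> 0" by simp
    qed (use y that in auto)
    then show "dconv U y \<le> 0" by (simp add: dconv_U_0)
  qed
  show ?thesis
    using *[of "\<bar>x\<bar>"] assms V_even[of x] by (auto simp: abs_if split: if_splits)
qed

text \<open>Beyond \<open>L\<close> the bound \<open>hm v \<le> v\<close> makes V convex. Thus V'(y)
  \<le> V'(X) \<le> V(X) for all X \<ge> y, and letting X tend to infinity gives V'(y) \<le>
  0.\<close>

lemma V_outer:
  assumes "L \<le> \<bar>x\<bar>"
  shows "V x \<le> V L"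
proof -
  have *: "V x \<le> V L" if "L \<le> x" for x
  proof (rule nonpos_deriv_imp_ge[OF that])
    fix y assume y: "y \<in> {L..x}"
    show "(V has_real_derivative dconv U y) (at y within {L..x})"
      using y by (intro V_derivs_outer) auto
    have "dconv U y \<le> V X" if X: "y \<le> X" for X
    proof -
      have "- dconv U X \<le> - dconv U y"
      proof (rule nonpos_deriv_imp_ge[OF X])
        fix z assume z: "z \<in> {y..X}"
        show "((\<lambda>x. - dconv U x) has_real_derivative - (V z - hm (V z))) (at z within {y..X})"
          using z y by (intro DERIV_minus V_derivs_outer) auto
        have "hm (V z) \<le> 1 * V z"
          using V_range(1)[of z] \<theta> by (intro order_trans[OF hm_le] mult_right_mono) auto
        then show "- (V z - hm (V z)) \<le> 0" by simp
      qed
      then show ?thesis using abs_dconv_U_le[of X] by simp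
    qed
    then show "dconv U y \<le> 0"
      by (intro tendsto_lowerbound[OF V_tendsto_0]) (auto simp: eventually_at_top_linorder)
  qed
  show ?thesis
    using *[of "\<bar>x\<bar>"] assms V_even[of x] by (auto simp: abs_if split: if_splits)
qed

text \<open>The energy is the same at every X \<ge> L and bounded there by 2 V(X), which vanishes at
  infinity.\<close>

lemma energy_outer: "(dconv U L)\<^sup>2 / 2 + potential hm (V L) = 0"
proof -
  let ?E = "\<lambda>x. (dconv U x)\<^sup>2 / 2 + potential hm (V x)"
  have E: "\<bar>?E L\<bar> \<le> 2 * V X" if X: "L \<le> X" for X
  proof -
    have "?E X = ?E L"
      using V_range by (intro energy_conserved[OF X hm_cont] V_derivs_outer) auto
    moreover have "\<bar>potential hm (V X)\<bar> \<le> V X"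
      using potential_lipschitz[OF hm_cont hm_range, of 0 "V X"] V_range[of X] by (simp add: potential_def)
    moreover have "(dconv U X)\<^sup>2 \<le> V X"
    proof -
      have "\<bar>dconv U X\<bar> * \<bar>dconv U X\<bar> \<le> V X * 1"
        using abs_dconv_U_le[of X] V_range[of X] by (intro mult_mono) auto
      then show ?thesis by (simp add: power2_eq_square)
    qed
    moreover have "0 \<le> (dconv U X)\<^sup>2" by simp
    ultimately show ?thesis by linarith
  qed
  have "((\<lambda>x. 2 * V x) \<longlongrightarrow> 2 * 0) at_top" by (intro tendsto_intros V_tendsto_0)
  then have "\<bar>?E L\<bar> \<le> 2 * 0"
    by (rule tendsto_lowerbound) (use E in \<open>auto simp: eventually_at_top_linorder\<close>)
  then show ?thesis by simp
qed

text \<open>Matching the inner and outer energies at \<open>L\<close> gives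
  \<open>?\<Phi> (V L) = potential hp (V 0)\<close>. This is within \<open>1 - V 0\<close> of
  \<open>potential hp 1 = ?\<Phi> vc\<close>. As the slope of \<open>?\<Phi>\<close> is at least
  \<open>1 - \<theta>\<close>, closeness of these values forces closeness of the arguments.\<close>

lemma interface_value:
  assumes vc: "0 \<le> vc" "vc \<le> 1" and bal: "potential hp vc - potential hm vc = potential hp 1"
  shows "(1 - \<theta>) * \<bar>V L - vc\<bar> \<le> exp (- (1 - \<theta>) * L) / \<theta>"
proof -
  let ?\<Phi> = "\<lambda>v. potential hp v - potential hm v"
  have mono: "(1 - \<theta>) * (w - v) \<le> ?\<Phi> w - ?\<Phi> v" if vw: "0 \<le> v" "v \<le> w" "w \<le> 1" for v w
  proof -
    have "(1 - \<theta>) * w - ?\<Phi> w \<le> (1 - \<theta>) * v - ?\<Phi> v"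
    proof (rule nonpos_deriv_imp_ge[OF \<open>v \<le> w\<close>])
      fix z assume z: "z \<in> {v..w}"
      have d: "(potential h has_real_derivative h z - z) (at z within {v..w})" if "continuous_on {0..1} h" for h
        by (rule DERIV_subset[OF potential_deriv[OF that]]) (use z vw in auto)
      show "((\<lambda>v. (1 - \<theta>) * v - ?\<Phi> v) has_real_derivative (1 - \<theta>) - ((hp z - z) - (hm z - z))) (at z within {v..w})"
        by (auto intro!: derivative_eq_intros d hp_cont hm_cont)
      \<comment> \<open>The two contraction bounds \<open>1 - hp z \<le> \<theta> * (1 - z)\<close>
        and \<open>hm z \<le> \<theta> * z\<close> add up to
        \<open>hp z - hm z \<ge> 1 - \<theta>\<close>.\<close>
      show "(1 - \<theta>) - ((hp z - z) - (hm z - z)) \<le> 0"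
        using hp_ge[of z] hm_le[of z] z vw by (simp add: algebra_simps)
    qed
    then show ?thesis by (simp add: algebra_simps)
  qed
  have "(dconv U L)\<^sup>2 / 2 + potential hp (V L) = (dconv U 0)\<^sup>2 / 2 + potential hp (V 0)"
    using V_range L by (intro energy_conserved[OF _ hp_cont] V_derivs_inner) auto
  then have "?\<Phi> (V L) = potential hp (V 0)"
    using energy_outer by (simp add: dconv_U_0)
  then have "\<bar>?\<Phi> (V L) - ?\<Phi> vc\<bar> \<le> 1 - V 0"
    using potential_lipschitz[OF hp_cont hp_range, of "V 0" 1] V_range[of 0] bal
    by (simp add: abs_minus_commute)
  also have "\<dots> \<le> exp (- (1 - \<theta>) * L) / \<theta>" using V_core[of 0] by simp
  finally have 1: "\<bar>?\<Phi> (V L) - ?\<Phi> vc\<bar> \<le> exp (- (1 - \<theta>) * L) / \<theta>" .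
  have "(1 - \<theta>) * \<bar>V L - vc\<bar> \<le> \<bar>?\<Phi> (V L) - ?\<Phi> vc\<bar>"
    using mono[of vc "V L"] mono[of "V L" vc] vc V_range[of L]
    by (cases "vc \<le> V L") auto
  with 1 show ?thesis by simp
qed

text \<open>The Harnack bound carries positivity from the origin to every point.\<close>

lemma V_pos:
  assumes "0 < V 0"
  shows "0 < V x"
proof -
  have "exp (- \<bar>0 - x\<bar>) * V 0 \<le> V x"
    using conv_harnack[OF H_lebesgue[OF V_cont] H_range, of 0 x]
    by (simp add: fun_cong[OF V_eq, symmetric])
  moreover have "0 < exp (- \<bar>0 - x\<bar>) * V 0" using assms by simp
  ultimately show ?thesis by linarith
qed

lemma U_tail: "U x \<le> exp (- (1 - \<theta>) * (\<bar>x\<bar> - L)) / \<theta>"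
proof (cases "\<bar>x\<bar> \<le> L")
  case True
  then have "0 \<le> - (1 - \<theta>) * (\<bar>x\<bar> - L)" using \<theta> by (intro mult_nonpos_nonpos) auto
  then have "1 \<le> exp (- (1 - \<theta>) * (\<bar>x\<bar> - L))" by simp
  moreover have "exp (- (1 - \<theta>) * (\<bar>x\<bar> - L)) \<le> exp (- (1 - \<theta>) * (\<bar>x\<bar> - L)) / \<theta>"
    using \<theta> by (simp add: field_simps)
  ultimately show ?thesis using H_range(2)[of x "V x"] by linarith
next
  case False
  have "U x \<le> 1 * V x"
    using False \<theta> V_range(1)[of x] by (simp add: H_def) (intro order_trans[OF hm_le], auto intro: mult_left_le_one_le)
  then show ?thesis using V_tail[of x] by simp
qed

lemma U_core: "\<bar>x\<bar> \<le> L \<Longrightarrow> 1 - U x \<le> exp (- (1 - \<theta>) * (L - \<bar>x\<bar>))"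
proof -
  assume "\<bar>x\<bar> \<le> L"
  then have "1 - U x \<le> \<theta> * (1 - V x)" using hp_ge[OF V_range(2)] by (simp add: H_def)
  also have "\<dots> \<le> \<theta> * (exp (- (1 - \<theta>) * (L - \<bar>x\<bar>)) / \<theta>)"
    using V_core[of x] \<theta> by (intro mult_left_mono) auto
  finally show ?thesis using \<theta> by simp
qed

lemma U_square_integrable: "integrable lebesgue (\<lambda>x. (U x)\<^sup>2)"
proof (rule Bochner_Integration.integrable_bound)
  \<comment> \<open>The factor 2 undoes the half in the kernel; with exponent
    \<open>\<theta>\<close> the weighted kernel times \<open>?C\<close> is exactly the tail bound of
    \<open>U\<close>, and U^2 \<le> U.\<close>
  let ?C = "2 * exp ((1 - \<theta>) * L) / \<theta>"
  show "integrable lebesgue (\<lambda>x. ?C * (kernel (0 - x) * exp (\<theta> * \<bar>0 - x\<bar>)))"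
    using has_bochner_integral_kernel_weight[OF \<theta>(2), of 0] by (intro integrable_mult_right) (auto simp: has_bochner_integral_iff)
  show "(\<lambda>x. (U x)\<^sup>2) \<in> borel_measurable lebesgue"
    by (intro borel_measurable_power H_lebesgue[OF V_cont])
  have "norm ((U x)\<^sup>2) \<le> norm (?C * (kernel (0 - x) * exp (\<theta> * \<bar>0 - x\<bar>)))" for x
  proof -
    have "norm ((U x)\<^sup>2) \<le> U x"
      using H_range[of x "V x"] by (simp add: power2_eq_square mult_left_le)
    also have "\<dots> \<le> exp (- (1 - \<theta>) * (\<bar>x\<bar> - L)) / \<theta>" by (rule U_tail)
    also have "\<dots> = ?C * (kernel (0 - x) * exp (\<theta> * \<bar>0 - x\<bar>))"
      by (simp add: kernel_def algebra_simps flip: exp_add)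
    also have "\<dots> \<le> norm (?C * (kernel (0 - x) * exp (\<theta> * \<bar>0 - x\<bar>)))"
      by (simp only: real_norm_def abs_ge_self)
    finally show ?thesis .
  qed
  then show "AE x in lebesgue. norm ((U x)\<^sup>2) \<le> norm (?C * (kernel (0 - x) * exp (\<theta> * \<bar>0 - x\<bar>)))"
    by simp
qed

lemma U_even: "U (- x) = U x"
  by (simp add: H_def V_even)

lemma U_tendsto_0: "(U \<longlongrightarrow> 0) at_top" "(U \<longlongrightarrow> 0) at_bot"
proof -
  show top: "(U \<longlongrightarrow> 0) at_top"
  proof (rule tendsto_sandwich[OF _ _ tendsto_const])
    show "((\<lambda>x. exp (- (1 - \<theta>) * (x - L)) / \<theta>) \<longlongrightarrow> 0) at_top"
      using \<theta> by real_asymp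
    show "\<forall>\<^sub>F x in at_top. U x \<le> exp (- (1 - \<theta>) * (x - L)) / \<theta>"
      using eventually_ge_at_top[of 0] by eventually_elim (use U_tail in \<open>metis abs_of_nonneg\<close>)
  qed (simp add: H_range)
  show "(U \<longlongrightarrow> 0) at_bot"
    unfolding filterlim_at_bot_mirror U_even by (rule top)
qed

text \<open>Away from the two interface points a single branch is active locally. At
  \<open>L\<close> the value is \<open>hp (V L)\<close> and the limit from the right is
  \<open>hm (V L)\<close>; these differ by at least \<open>1 - \<theta>\<close>.\<close>

lemma U_discontinuities: "{x. \<not> isCont U x} = {- L, L}"
proof -
  have hpV: "continuous_on UNIV (\<lambda>x. hp (V x))" and hmV: "continuous_on UNIV (\<lambda>x. hm (V x))"
    by (rule continuous_on_compose2[OF hp_cont[of UNIV] V_cont], simp)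
      (rule continuous_on_compose2[OF hm_cont[of UNIV] V_cont], simp)
  have inner: "isCont U x" if "\<bar>x\<bar> < L" for x
  proof -
    have "\<forall>\<^sub>F y in nhds x. y \<in> {-L<..<L}"
      using that by (intro eventually_nhds_in_open) auto
    then have "\<forall>\<^sub>F y in nhds x. U y = hp (V y)" by eventually_elim (auto simp: H_def)
    then show ?thesis
      using hpV by (subst isCont_cong) (auto simp: continuous_on_eq_continuous_at)
  qed
  have outer: "isCont U x" if "L < \<bar>x\<bar>" for x
  proof -
    have "\<forall>\<^sub>F y in nhds x. y \<in> - {-L..L}"
      using that by (intro eventually_nhds_in_open) (auto simp: abs_le_iff)
    then have "\<forall>\<^sub>F y in nhds x. U y = hm (V y)" by eventually_elim (auto simp: H_def)
    then show ?thesis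
      using hmV by (subst isCont_cong) (auto simp: continuous_on_eq_continuous_at)
  qed
  have jump: "\<not> isCont U L"
  proof
    assume "isCont U L"
    then have "(U \<longlongrightarrow> U L) (at_right L)"
      by (simp add: isCont_def filterlim_at_split)
    moreover have "\<forall>\<^sub>F x in at_right L. U x = hm (V x)"
      using L by (auto simp: eventually_at_filter H_def)
    ultimately have "((\<lambda>x. hm (V x)) \<longlongrightarrow> U L) (at_right L)"
      by (rule Lim_transform_eventually)
    moreover have "((\<lambda>x. hm (V x)) \<longlongrightarrow> hm (V L)) (at_right L)"
      using hmV by (simp add: continuous_on_eq_continuous_at isCont_def filterlim_at_split)
    ultimately have "U L = hm (V L)"
      by (rule tendsto_unique[rotated]) simp
    then show False
      using hp_ge[OF V_range(2)[of L]] hm_le[OF V_range(1)[of L]] \<theta> L by (simp add: H_def algebra_simps)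
  qed
  have "\<not> isCont U (- L)"
  proof
    assume "isCont U (- L)"
    then have "isCont (\<lambda>x. U (- x)) L" by (intro isCont_o2[where f = uminus and g = U and a = L]) auto
    then show False using jump by (simp only: U_even)
  qed
  moreover have "x = L \<or> x = - L \<or> \<bar>x\<bar> < L \<or> L < \<bar>x\<bar>" for x by linarith
  ultimately show ?thesis using jump inner outer by blast
qed

end

end

section \<open>Comparison principle\<close>

text \<open>The differential inequality is demanded only where \<open>y\<close> is positive. It is
  in force after the last time \<open>s\<close> before \<open>t\<close> with
  \<open>y s \<le> 0\<close>, so \<open>exp (- K * r) * y r\<close> cannot increase from
  \<open>s\<close> to \<open>t\<close>.\<close>

lemma gronwall_nonpos:
  fixes y :: "real \<Rightarrow> real"
  assumes cont: "continuous_on {0..T} y" and y0: "y 0 \<le> 0"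
    and deriv: "\<And>t. 0 < t \<Longrightarrow> t \<le> T \<Longrightarrow> (y has_real_derivative y' t) (at t)"
    and le: "\<And>t. 0 < t \<Longrightarrow> t \<le> T \<Longrightarrow> 0 < y t \<Longrightarrow> y' t \<le> K * y t"
    and t: "t \<in> {0..T}"
  shows "y t \<le> 0"
proof (rule ccontr)
  assume pos: "\<not> y t \<le> 0"
  define S where "S = {0..t} \<inter> y -` {..0}"
  have ct: "continuous_on {0..t} y" by (rule continuous_on_subset[OF cont]) (use t in auto)
  have "compact S"
    unfolding S_def compact_eq_bounded_closed
    by (auto intro!: continuous_closed_preimage[OF ct] intro: bounded_subset[of "{0..t}"])
  moreover have "0 \<in> S" using y0 t by (auto simp: S_def)
  ultimately obtain s where s: "s \<in> S" and max: "\<And>r. r \<in> S \<Longrightarrow> r \<le> s"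
    using compact_attains_sup[of S] by blast
  have st: "0 \<le> s" "s < t" "y s \<le> 0" using s pos by (auto simp: S_def less_le)
  have y_pos: "0 < y r" if "s < r" "r \<le> t" for r
    using max[of r] that st by (cases "0 < y r") (auto simp: S_def not_less)
  have "exp (- K * t) * y t \<le> exp (- K * s) * y s"
  proof (rule DERIV_nonpos_imp_decreasing_open[where f = "\<lambda>t. exp (- K * t) * y t"])
    fix r assume r: "s < r" "r < t"
    have "((\<lambda>t. exp (- K * t) * y t) has_real_derivative exp (- K * r) * (y' r - K * y r)) (at r)"
      using r st t by (auto intro!: derivative_eq_intros deriv simp: algebra_simps)
    moreover have "exp (- K * r) * (y' r - K * y r) \<le> 0"
      using le[of r] y_pos[of r] r st t by (intro mult_nonneg_nonpos) auto
    ultimately show "\<exists>D. ((\<lambda>t. exp (- K * t) * y t) has_real_derivative D) (at r) \<and> D \<le> 0" by blast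
  next
    show "continuous_on {s..t} (\<lambda>t. exp (- K * t) * y t)"
      using st by (intro continuous_intros continuous_on_subset[OF ct]) auto
  qed (use st in auto)
  moreover have "exp (- K * s) * y s \<le> 0" using st by (simp add: mult_nonneg_nonpos)
  moreover have "0 < exp (- K * t) * y t" using pos by simp
  ultimately show False by simp
qed

lemma C1_imp_lipschitz_on_Icc:
  fixes f :: "real \<Rightarrow> real"
  assumes d: "\<And>x. (f has_real_derivative f' x) (at x)" and c: "continuous_on UNIV f'"
  obtains K where "0 \<le> K" "\<And>x y. x \<in> {a..b} \<Longrightarrow> y \<in> {a..b} \<Longrightarrow> \<bar>f x - f y\<bar> \<le> K * \<bar>x - y\<bar>"
proof -
  have "compact (f' ` {a..b})"
    by (intro compact_continuous_image continuous_on_subset[OF c]) auto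
  then have "bounded (f' ` {a..b})" by (rule compact_imp_bounded)
  then obtain K where K: "\<And>x. x \<in> {a..b} \<Longrightarrow> \<bar>f' x\<bar> \<le> K"
    unfolding bounded_iff by (metis imageI real_norm_def)
  have "\<bar>f x - f y\<bar> \<le> max K 0 * \<bar>x - y\<bar>" if "x \<in> {a..b}" "y \<in> {a..b}" for x y
    using field_differentiable_bound[of "{a..b}" f f' "max K 0" x y] that K
    by (auto simp: has_field_derivative_at_within[OF d] le_max_iff_disj)
  then show thesis using that[of "max K 0"] by auto
qed

section \<open>Uniform bounds for continuous curves of integrable, essentially bounded
  functions\<close>

lemma AE_le_norm_L1_Linf:
  assumes "v \<in> L1_Linf"
  shows "AE x in lebesgue. \<bar>v x\<bar> \<le> norm_L1_Linf v"
proof -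
  let ?E = "esssup lebesgue (\<lambda>x. ereal \<bar>v x\<bar>)"
  obtain C where C: "AE x in lebesgue. \<bar>v x\<bar> \<le> C" and int: "integrable lebesgue v"
    using assms by (auto simp: L1_Linf_def)
  \<comment> \<open>Finiteness matters, since \<open>real_of_ereal\<close> sends an infinite
    supremum to 0.\<close>
  have "?E \<le> ereal C"
    using C int by (intro esssup_I) auto
  have "AE x in lebesgue. ereal \<bar>v x\<bar> \<le> ?E" by (rule esssup_AE)
  then show ?thesis
  proof eventually_elim
    case (elim x)
    with \<open>?E \<le> ereal C\<close> have "\<bar>v x\<bar> \<le> real_of_ereal ?E"
      by (cases ?E) auto
    moreover have "0 \<le> (LINT x|lebesgue. \<bar>v x\<bar>)" by simp
    ultimately show ?case unfolding norm_L1_Linf_def by linarith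
  qed
qed

lemma L1_Linf_diff:
  assumes "v \<in> L1_Linf" "w \<in> L1_Linf"
  shows "(\<lambda>x. v x - w x) \<in> L1_Linf"
proof -
  obtain C C' where *: "AE x in lebesgue. \<bar>v x\<bar> \<le> C" "AE x in lebesgue. \<bar>w x\<bar> \<le> C'"
    using assms by (auto simp: L1_Linf_def)
  then have "AE x in lebesgue. \<bar>v x - w x\<bar> \<le> C + C'"
    by eventually_elim linarith
  then show ?thesis using assms by (auto simp: L1_Linf_def)
qed

text \<open>Norm continuity gives a bound near each time, and compactness of [0, T] a common one.
  The exceptional null set may still depend on \<open>t\<close>.\<close>

lemma C0_L1_Linf_bounded:
  assumes u: "C0_L1_Linf {0..} u"
  shows "\<exists>M. \<forall>t\<in>{0..T}. AE x in lebesgue. \<bar>u t x\<bar> \<le> M"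
proof -
  have L: "u t \<in> L1_Linf" if "0 \<le> t" for t
    using u that by (auto simp: C0_L1_Linf_def)
  have "\<exists>e B. 0 < e \<and> (\<forall>s\<ge>0. dist s t < e \<longrightarrow> (AE x in lebesgue. \<bar>u s x\<bar> \<le> B))" if t: "0 \<le> t" for t
  proof -
    have "((\<lambda>s. norm_L1_Linf (\<lambda>x. u s x - u t x)) \<longlongrightarrow> 0) (at t within {0..})"
      using u t by (auto simp: C0_L1_Linf_def)
    then have "\<forall>\<^sub>F s in at t within {0..}. norm_L1_Linf (\<lambda>x. u s x - u t x) < 1"
      by (rule order_tendstoD) simp
    then obtain e where e: "0 < e"
      "\<And>s. 0 \<le> s \<Longrightarrow> s \<noteq> t \<Longrightarrow> dist s t < e \<Longrightarrow> norm_L1_Linf (\<lambda>x. u s x - u t x) < 1"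
      by (auto simp: eventually_at)
    have "AE x in lebesgue. \<bar>u s x\<bar> \<le> norm_L1_Linf (u t) + 1" if s: "0 \<le> s" "dist s t < e" for s
    proof (cases "s = t")
      case True
      show ?thesis using AE_le_norm_L1_Linf[OF L[OF t]] True by auto
    next
      case False
      show ?thesis
        using AE_le_norm_L1_Linf[OF L[OF t]] AE_le_norm_L1_Linf[OF L1_Linf_diff[OF L[OF s(1)] L[OF t]]]
      proof eventually_elim
        case (elim x)
        then show ?case using e(2)[OF s(1) False s(2)] by linarith
      qed
    qed
    with \<open>0 < e\<close> show ?thesis by blast
  qed
  then obtain e B where
    eB: "\<forall>t\<ge>0. 0 < e t \<and> (\<forall>s\<ge>0. dist s t < e t \<longrightarrow> (AE x in lebesgue. \<bar>u s x\<bar> \<le> B t))"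
    by metis
  then have e: "\<And>t. 0 \<le> t \<Longrightarrow> 0 < e t"
    and B: "\<And>t s. 0 \<le> t \<Longrightarrow> 0 \<le> s \<Longrightarrow> dist s t < e t \<Longrightarrow> AE x in lebesgue. \<bar>u s x\<bar> \<le> B t"
    by blast+
  obtain D where D: "D \<subseteq> {0..T}" "finite D" "{0..T} \<subseteq> (\<Union>t\<in>D. ball t (e t))"
    by (rule compactE_image[of "{0..T}" "{0..T}" "\<lambda>t. ball t (e t)"]) (use e in force)+
  have "AE x in lebesgue. \<bar>u s x\<bar> \<le> (\<Sum>t\<in>D. \<bar>B t\<bar>)" if s: "s \<in> {0..T}" for s
  proof -
    obtain t where t: "t \<in> D" "dist s t < e t" using D(3) s by (auto simp: dist_commute)
    have Bt: "B t \<le> (\<Sum>t\<in>D. \<bar>B t\<bar>)"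
      using member_le_sum[of t D "\<lambda>t. \<bar>B t\<bar>"] t(1) D(2) by auto
    have "AE x in lebesgue. \<bar>u s x\<bar> \<le> B t" using B[of t s] t D(1) s by auto
    then show ?thesis by eventually_elim (use Bt in linarith)
  qed
  then show ?thesis by blast
qed

text \<open>A null set independent of \<open>t\<close> is obtained from the countably many rational
  times; pointwise continuity in time covers the remaining ones.\<close>

lemma C0_L1_Linf_bounded_AE:
  assumes u: "C0_L1_Linf {0..} u" and c: "\<And>x. continuous_on {0..} (\<lambda>t. u t x)"
  shows "\<exists>M. AE x in lebesgue. \<forall>t\<in>{0..T}. \<bar>u t x\<bar> \<le> M"
proof -
  \<comment> \<open>The extra unit of time leaves room for a rational to the right of
    \<open>t = T\<close>.\<close>
  obtain M where M: "\<forall>t\<in>{0..T + 1}. AE x in lebesgue. \<bar>u t x\<bar> \<le> M"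
    using C0_L1_Linf_bounded[OF u] by blast
  have "AE x in lebesgue. \<forall>t\<in>\<rat> \<inter> {0..T + 1}. \<bar>u t x\<bar> \<le> M"
    using M by (subst AE_ball_countable) (auto intro: countable_subset[OF _ countable_rat])
  then have "AE x in lebesgue. \<forall>t\<in>{0..T}. \<bar>u t x\<bar> \<le> M"
  proof eventually_elim
    case (elim x)
    show ?case
    proof (intro ballI leI notI)
      fix t assume t: "t \<in> {0..T}" and gt: "M < \<bar>u t x\<bar>"
      have "((\<lambda>s. \<bar>u s x\<bar>) \<longlongrightarrow> \<bar>u t x\<bar>) (at t within {0..})"
        using c[of x] t by (intro tendsto_rabs) (auto simp: continuous_on_def)
      then have "\<forall>\<^sub>F s in at t within {0..}. M < \<bar>u s x\<bar>"
        using gt by (rule order_tendstoD)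
      then obtain e where e: "0 < e" "\<And>s. 0 \<le> s \<Longrightarrow> s \<noteq> t \<Longrightarrow> dist s t < e \<Longrightarrow> M < \<bar>u s x\<bar>"
        by (auto simp: eventually_at)
      obtain r where r: "r \<in> \<rat>" "t < r" "r < min (t + e) (T + 1)"
        using Rats_dense_in_real[of t "min (t + e) (T + 1)"] e(1) t by auto
      then have "\<bar>u r x\<bar> \<le> M" using elim t by simp
      then show False using e(2)[of r] r t by (simp add: dist_real_def)
    qed
  qed
  then show ?thesis by blast
qed

section \<open>The decaying supersolution\<close>

locale supersolution =
  fixes d q \<delta> l C :: real and f f' U :: "real \<Rightarrow> real" and u :: "real \<Rightarrow> real \<Rightarrow> real"
  assumes d: "0 < d" and q: "0 \<le> q" and \<delta>: "0 < \<delta>"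
    and f_deriv: "\<And>x. (f has_real_derivative f' x) (at x)" and f'_cont: "continuous_on UNIV f'"
    and sol: "cauchy_solution d f l u"
    and U_meas: "U \<in> borel_measurable lebesgue" and U_bound: "\<And>x. \<bar>U x\<bar> \<le> C"
    and U_stat: "\<And>x. 0 = d * (- U x + conv kernel U x) + f (U x)"
    and U_stable: "\<And>x s. 0 \<le> s \<Longrightarrow> s \<le> q \<Longrightarrow> f (U x + s) \<le> f (U x) - \<delta> * s"
    and init: "\<And>x. indicator {-l..l} x \<le> U x + q"
begin

text \<open>Adding a constant s in space leaves -U + K * U unchanged, since the kernel has mass one,
  and by \<open>U_stable\<close> the reaction changes by at most \<open>- \<delta> * s\<close>. For
  s = q exp(-\<delta> t) this is exactly the time derivative of s, so \<open>w\<close> is a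
  supersolution.\<close>

definition w :: "real \<Rightarrow> real \<Rightarrow> real" where
  "w t x = U x + q * exp (- \<delta> * t)"

lemma u_cont: "continuous_on {0..} (\<lambda>t. u t x)"
  and u_C0: "C0_L1_Linf {0..} u"
  and u_init: "u 0 x = indicator {-l..l} x"
  using sol by (simp_all add: cauchy_solution_def)

lemma u_deriv: "0 < t \<Longrightarrow> ((\<lambda>s. u s x) has_real_derivative d * (- u t x + conv kernel (u t) x) + f (u t x)) (at t)"
  using sol by (simp add: cauchy_solution_def)

lemma exp_bounds: "0 \<le> t \<Longrightarrow> 0 \<le> q * exp (- \<delta> * t) \<and> q * exp (- \<delta> * t) \<le> q"
  using q \<delta> by (simp add: mult_left_le)

text \<open>The integral ignores null sets, so an almost everywhere bound on \<open>u t\<close>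
  controls the nonlocal term at every single \<open>x\<close>.\<close>

lemma conv_u_le:
  assumes t: "0 \<le> t" and "AE y in lebesgue. u t y \<le> w t y + k"
  shows "conv kernel (u t) x \<le> conv kernel U x + q * exp (- \<delta> * t) + k"
proof -
  have "u t \<in> L1_Linf" using u_C0 t by (auto simp: C0_L1_Linf_def)
  then obtain B where B: "u t \<in> borel_measurable lebesgue" "AE y in lebesgue. \<bar>u t y\<bar> \<le> B"
    by (auto simp: L1_Linf_def)
  let ?c = "q * exp (- \<delta> * t) + k"
  have "\<bar>U y + ?c\<bar> \<le> C + \<bar>?c\<bar>" for y using U_bound[of y] by linarith
  then have "conv kernel (u t) x \<le> conv kernel (\<lambda>y. U y + ?c) x"
    using assms(2) by (intro conv_mono[OF B, of _ "C + \<bar>?c\<bar>"]) (auto simp: w_def add.assoc intro!: borel_measurable_add U_meas)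
  also have "\<dots> = conv kernel U x + ?c"
    by (rule conv_add_const[OF U_meas, of C]) (simp add: U_bound)
  finally show ?thesis by simp
qed

text \<open>Each application halves the constant \<open>c\<close> of an almost everywhere bound, so iteration gives
  \<open>u t \<le> w t\<close> almost everywhere; the case \<open>c = 0\<close> then upgrades this to every \<open>x\<close>.\<close>

lemma pointwise_comparison:
  assumes c: "0 \<le> c" and K: "0 \<le> K" "K + 2 * d \<le> \<mu>"
    and lip: "\<And>v w. v \<in> {-M..M} \<Longrightarrow> w \<in> {-M..M} \<Longrightarrow> \<bar>f v - f w\<bar> \<le> K * \<bar>v - w\<bar>"
    and uM: "\<And>t. t \<in> {0..T} \<Longrightarrow> \<bar>u t x\<bar> \<le> M" and CM: "C + q \<le> M"
    and ae: "\<And>t. t \<in> {0..T} \<Longrightarrow> AE y in lebesgue. u t y \<le> w t y + c * exp (\<mu> * t)"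
    and t: "t \<in> {0..T}"
  shows "u t x \<le> w t x + c / 2 * exp (\<mu> * t)"
proof -
  let ?y = "\<lambda>t. u t x - w t x - c / 2 * exp (\<mu> * t)"
  have "?y t \<le> 0"
  proof (rule gronwall_nonpos[OF _ _ _ _ t, where K = K and y' = "\<lambda>t.
      d * (- u t x + conv kernel (u t) x) + f (u t x) + \<delta> * (q * exp (- \<delta> * t)) - \<mu> * (c / 2 * exp (\<mu> * t))"])
    show "continuous_on {0..T} ?y"
      unfolding w_def by (intro continuous_intros continuous_on_subset[OF u_cont]) auto
    show "?y 0 \<le> 0" using init[of x] c by (simp add: u_init w_def)
  next
    fix t :: real assume t: "0 < t" "t \<le> T"
    show "(?y has_real_derivative d * (- u t x + conv kernel (u t) x) + f (u t x)
        + \<delta> * (q * exp (- \<delta> * t)) - \<mu> * (c / 2 * exp (\<mu> * t))) (at t)"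
      unfolding w_def by (auto intro!: derivative_eq_intros u_deriv t)
    assume y: "0 < ?y t"
    let ?E = "exp (\<mu> * t)" and ?e = "q * exp (- \<delta> * t)"
    have cE: "0 \<le> c * ?E" using c by simp
    have e: "0 \<le> ?e" "?e \<le> q" using exp_bounds[of t] t by auto
    have wM: "\<bar>w t x\<bar> \<le> M" using U_bound[of x] e CM by (simp add: w_def abs_le_iff)
    have z: "0 \<le> u t x - w t x" using y cE by linarith
    have "\<bar>f (u t x) - f (w t x)\<bar> \<le> K * \<bar>u t x - w t x\<bar>"
      using uM[of t] wM t by (intro lip) (auto simp: abs_le_iff)
    then have 1: "f (u t x) \<le> f (w t x) + K * (u t x - w t x)" using z by linarith
    have 2: "f (w t x) \<le> f (U x) - \<delta> * ?e" unfolding w_def by (rule U_stable[OF e])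
    have 3: "d * conv kernel (u t) x \<le> d * (conv kernel U x + ?e + c * ?E)"
      using d t ae[of t] by (intro mult_left_mono conv_u_le) auto
    have 4: "0 \<le> d * (u t x - w t x)" using d z by simp
    \<comment> \<open>The nonlocal term contributes \<open>d * c * ?E\<close>, while the claim
      involves only \<open>c / 2\<close>. Absorbing both this and the Lipschitz term requires
      \<open>K * c / 2 + d * c \<le> \<mu> * c / 2\<close>, whence \<open>K + 2 * d\<close>.\<close>
    have 5: "(K + 2 * d) * (c * ?E) \<le> \<mu> * (c * ?E)" by (rule mult_right_mono[OF K(2) cE])
    have 6: "w t x = U x + ?e" by (simp add: w_def)
    show "d * (- u t x + conv kernel (u t) x) + f (u t x) + \<delta> * ?e - \<mu> * (c / 2 * ?E) \<le> K * ?y t"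
      using 1 2 3 4 5 U_stat[of x] unfolding 6 by (simp add: algebra_simps)
  qed
  then show ?thesis by simp
qed

lemma AE_comparison: "AE x in lebesgue. \<forall>t\<in>{0..T}. u t x \<le> w t x"
proof -
  obtain M0 where M0: "AE x in lebesgue. \<forall>t\<in>{0..T}. \<bar>u t x\<bar> \<le> M0"
    using C0_L1_Linf_bounded_AE[OF u_C0 u_cont] by blast
  define M where "M = max M0 (C + q)"
  obtain K where K: "0 \<le> K" "\<And>x y. x \<in> {-M..M} \<Longrightarrow> y \<in> {-M..M} \<Longrightarrow> \<bar>f x - f y\<bar> \<le> K * \<bar>x - y\<bar>"
    using C1_imp_lipschitz_on_Icc[OF f_deriv f'_cont] by blast
  define \<mu> where "\<mu> = K + 2 * d"
  have \<mu>: "0 \<le> \<mu>" using K d by (simp add: \<mu>_def)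
  have C: "0 \<le> C" using U_bound[of 0] by linarith
  then have M: "0 \<le> M + C" using q by (simp add: M_def)
  \<comment> \<open>\<open>M + C\<close> is a valid initial constant because
    \<open>u \<le> M\<close> almost everywhere and \<open>w \<ge> - C\<close>.\<close>
  have "AE x in lebesgue. \<forall>t\<in>{0..T}. u t x \<le> w t x + (M + C) / 2 ^ n * exp (\<mu> * t)" for n
  proof (induction n)
    case 0
    show ?case using M0
    proof (eventually_elim, intro ballI)
      fix x t assume "\<forall>t\<in>{0..T}. \<bar>u t x\<bar> \<le> M0" and t: "t \<in> {0..T}"
      then have "u t x \<le> M" by (force simp: M_def abs_le_iff)
      moreover have "- C \<le> w t x" using exp_bounds[of t] t U_bound[of x] by (simp add: w_def abs_le_iff)
      moreover have "(M + C) * 1 \<le> (M + C) * exp (\<mu> * t)"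
        using M \<mu> t by (intro mult_left_mono) auto
      ultimately show "u t x \<le> w t x + (M + C) / 2 ^ 0 * exp (\<mu> * t)" by simp
    qed
  next
    case (Suc n)
    have ae: "AE y in lebesgue. u t y \<le> w t y + (M + C) / 2 ^ n * exp (\<mu> * t)" if "t \<in> {0..T}" for t
      using Suc by eventually_elim (use that in blast)
    show ?case using M0
    proof (eventually_elim, intro ballI)
      fix x t assume M0: "\<forall>t\<in>{0..T}. \<bar>u t x\<bar> \<le> M0" and t: "t \<in> {0..T}"
      have "u t x \<le> w t x + (M + C) / 2 ^ n / 2 * exp (\<mu> * t)"
        by (rule pointwise_comparison[OF _ K(1) _ K(2) _ _ ae t])
          (use M0 M in \<open>auto simp: \<mu>_def M_def le_max_iff_disj\<close>)
      then show "u t x \<le> w t x + (M + C) / 2 ^ Suc n * exp (\<mu> * t)" by (simp add: mult.commute)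
    qed
  qed
  then have "AE x in lebesgue. \<forall>n. \<forall>t\<in>{0..T}. u t x \<le> w t x + (M + C) / 2 ^ n * exp (\<mu> * t)"
    unfolding AE_all_countable by blast
  then show ?thesis
  proof (eventually_elim, intro ballI)
    fix x t assume *: "\<forall>n. \<forall>t\<in>{0..T}. u t x \<le> w t x + (M + C) / 2 ^ n * exp (\<mu> * t)" and t: "t \<in> {0..T}"
    have "(\<lambda>n. w t x + (M + C) / 2 ^ n * exp (\<mu> * t)) \<longlonglongrightarrow> w t x + 0 * exp (\<mu> * t)"
      by (intro tendsto_intros LIMSEQ_divide_realpow_zero) auto
    then show "u t x \<le> w t x"
      using * t by (intro LIMSEQ_le_const[of _ "w t x" "u t x"]) auto
  qed
qed

lemma comparison:
  assumes "0 \<le> t"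
  shows "u t x \<le> U x + q * exp (- \<delta> * t)"
proof -
  \<comment> \<open>The almost everywhere bound may fail at this particular \<open>x\<close>, so
    \<open>M0\<close> is taken from the orbit at \<open>x\<close> alone.\<close>
  have "bounded ((\<lambda>s. u s x) ` {0..t})"
    by (intro compact_imp_bounded compact_continuous_image continuous_on_subset[OF u_cont]) auto
  then obtain M0 where M0: "\<And>s. s \<in> {0..t} \<Longrightarrow> \<bar>u s x\<bar> \<le> M0"
    unfolding bounded_iff by (metis (mono_tags, lifting) imageI real_norm_def)
  define M where "M = max M0 (C + q)"
  obtain K where K: "0 \<le> K" "\<And>x y. x \<in> {-M..M} \<Longrightarrow> y \<in> {-M..M} \<Longrightarrow> \<bar>f x - f y\<bar> \<le> K * \<bar>x - y\<bar>"
    using C1_imp_lipschitz_on_Icc[OF f_deriv f'_cont] by blast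
  have ae: "AE y in lebesgue. u s y \<le> w s y + 0 * exp ((K + 2 * d) * s)" if "s \<in> {0..t}" for s
    using AE_comparison[of t] by eventually_elim (use that in auto)
  have "u t x \<le> w t x + 0 / 2 * exp ((K + 2 * d) * t)"
    by (rule pointwise_comparison[OF _ K(1) _ K(2) _ _ ae])
      (use M0 assms in \<open>auto simp: M_def le_max_iff_disj\<close>)
  then show ?thesis by (simp add: w_def)
qed

end

section \<open>Ground states with a prescribed jump\<close>

text \<open>Where \<open>g\<close> expands by \<open>1 / \<theta>\<close> its inverse contracts by
  \<open>\<theta>\<close>, and clipping does not increase distances. The inverse is taken on the
  larger set \<open>S\<close> to coincide with the one in \<open>G_minus\<close> and
  \<open>G_plus\<close>.\<close>

lemma clipped_inverse:
  fixes g :: "real \<Rightarrow> real"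
  assumes ab: "a \<le> b" "{a..b} \<subseteq> S" and inj: "inj_on g S" and cont: "continuous_on {a..b} g"
    and \<theta>: "0 < \<theta>"
    and expand: "\<And>x y. x \<in> {a..b} \<Longrightarrow> y \<in> {a..b} \<Longrightarrow> x \<le> y \<Longrightarrow> y - x \<le> \<theta> * (g y - g x)"
  defines "h \<equiv> \<lambda>v. inv_into S g (max (g a) (min (g b) v))"
  shows "h v \<in> {a..b}"
    and "v \<in> {g a..g b} \<Longrightarrow> g (h v) = v"
    and "x \<in> {a..b} \<Longrightarrow> h (g x) = x"
    and "\<bar>h v - h w\<bar> \<le> \<theta> * \<bar>v - w\<bar>"
    and "v \<in> {g a..g b} \<Longrightarrow> h v = inv_into S g v"
proof -
  have mono: "g x \<le> g y" if "x \<in> {a..b}" "y \<in> {a..b}" "x \<le> y" for x y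
  proof -
    have "0 \<le> \<theta> * (g y - g x)" using expand[OF that] that(3) by linarith
    then show ?thesis using \<theta> by (simp add: zero_le_mult_iff)
  qed
  have gab: "g a \<le> g b" using ab by (intro mono) auto
  have *: "h v \<in> {a..b} \<and> g (h v) = max (g a) (min (g b) v)" for v
  proof -
    have "\<exists>x\<ge>a. x \<le> b \<and> g x = max (g a) (min (g b) v)"
      using gab ab cont by (intro IVT') auto
    then obtain x where x: "x \<in> {a..b}" "g x = max (g a) (min (g b) v)" by auto
    then have "h v = x" unfolding h_def by (metis inv_into_f_f[OF inj] subsetD[OF ab(2)])
    with x show ?thesis by simp
  qed
  show "h v \<in> {a..b}" using * by blast
  show "v \<in> {g a..g b} \<Longrightarrow> g (h v) = v" using * by auto
  show "v \<in> {g a..g b} \<Longrightarrow> h v = inv_into S g v" by (simp add: h_def)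
  show "h (g x) = x" if x: "x \<in> {a..b}"
  proof -
    have "g x \<in> {g a..g b}" using x ab by (auto intro!: mono)
    then show ?thesis using x ab by (simp add: h_def inv_into_f_f[OF inj] subset_iff)
  qed
  have le: "h v - h w \<le> \<theta> * \<bar>v - w\<bar>" if "h w \<le> h v" for v w
  proof -
    have "h v - h w \<le> \<theta> * (g (h v) - g (h w))" using * that by (intro expand) auto
    also have "\<dots> \<le> \<theta> * \<bar>v - w\<bar>"
    proof (rule mult_left_mono)
      have "max (g a) (min (g b) v) - max (g a) (min (g b) w) \<le> \<bar>v - w\<bar>"
        by (auto simp: max_def min_def)
      then show "g (h v) - g (h w) \<le> \<bar>v - w\<bar>" using * by simp
    qed (use \<theta> in simp)
    finally show ?thesis .
  qed
  show "\<bar>h v - h w\<bar> \<le> \<theta> * \<bar>v - w\<bar>"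
    using le[of v w] le[of w v] by (cases "h w \<le> h v") (auto simp: abs_minus_commute)
qed

lemma smooth_derivs:
  assumes "smooth f"
  shows "(f has_real_derivative deriv f x) (at x)" and "continuous_on UNIV (deriv f)"
proof -
  have "f differentiable at x" using assms[unfolded smooth_def, rule_format, of 0] by simp
  then show "(f has_real_derivative deriv f x) (at x)"
    by (simp add: DERIV_deriv_iff_real_differentiable)
  have "deriv f differentiable at x" for x using assms[unfolded smooth_def, rule_format, of 1] by simp
  then show "continuous_on UNIV (deriv f)"
    by (auto intro!: continuous_at_imp_continuous_on differentiable_imp_continuous_within)
qed

lemma integral_potential:
  fixes a b :: real
  assumes "continuous_on {a..b} h" "a \<le> b"
  shows "integral {a..b} (\<lambda>w. h w - w) = integral {a..b} h - (b\<^sup>2 - a\<^sup>2) / 2"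
proof -
  have "integral {a..b} (\<lambda>w. h w - w) = integral {a..b} h - integral {a..b} (\<lambda>w. w)"
    by (intro Henstock_Kurzweil_Integration.integral_diff integrable_continuous_interval assms continuous_intros)
  then show ?thesis using ident_has_integral[OF assms(2)] by (simp add: integral_unique)
qed

text \<open>The lower potential at \<open>vc\<close> is \<open>G_minus\<close> itself. For the upper
  branch only the increment from \<open>vc\<close> to 1 is compared with \<open>G_plus\<close>,
  because further down the clipped branch may differ from the inverse; the balance involves just
  this increment.\<close>

lemma balance_condition:
  assumes hm: "continuous_on UNIV hm" "\<And>w. w \<in> {0..vc} \<Longrightarrow> hm w = inv_into {0..\<beta>} g w"
    and hp: "continuous_on UNIV hp" "\<And>w. w \<in> {vc..1} \<Longrightarrow> hp w = inv_into {\<gamma>..1} g w"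
    and vc: "0 \<le> vc" "vc \<le> 1"
    and eq: "G_plus g \<gamma> vc - G_minus g \<beta> vc = G_plus g \<gamma> 1"
  shows "potential hp vc - potential hm vc = potential hp 1"
proof -
  have c: "continuous_on A hm" "continuous_on A hp" for A
    using hm hp by (auto intro: continuous_on_subset)
  have i: "integral {0..vc} (inv_into {0..\<beta>} g) = integral {0..vc} hm"
    "integral {vc..1} (inv_into {\<gamma>..1} g) = integral {vc..1} hp"
    by (intro integral_cong, simp add: hm(2) hp(2))+
  have 1: "potential hm vc = G_minus g \<beta> vc"
    using integral_potential[OF c(1) vc(1)] by (simp add: potential_def G_minus_def i)
  have "potential hp vc + integral {vc..1} (\<lambda>w. hp w - w) = potential hp 1"
    unfolding potential_def
    by (intro Henstock_Kurzweil_Integration.integral_combine vc integrable_continuous_interval continuous_intros c)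
  then have "potential hp 1 - potential hp vc = G_plus g \<gamma> 1 - G_plus g \<gamma> vc"
    using integral_potential[OF c(2) vc(2)] by (simp add: G_plus_def i diff_divide_distrib)
  with 1 eq show ?thesis by simp
qed

lemma negative_on_compact:
  fixes F :: "real \<Rightarrow> real"
  assumes "compact S" "continuous_on S F" "\<And>x. x \<in> S \<Longrightarrow> F x < 0"
  obtains \<delta> where "0 < \<delta>" "\<And>x. x \<in> S \<Longrightarrow> F x \<le> - \<delta>"
proof (cases "S = {}")
  case True
  then show ?thesis using that[of 1] by simp
next
  case False
  then obtain z where "z \<in> S" "\<And>x. x \<in> S \<Longrightarrow> F x \<le> F z"
    using continuous_attains_sup[OF assms(1) _ assms(2)] by blast
  then show ?thesis using that[of "- F z"] assms(3) by simp
qed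

lemma deriv_bound_imp_le:
  fixes f :: "real \<Rightarrow> real"
  assumes "\<And>x. (f has_real_derivative f' x) (at x)" "a \<le> b" "\<And>x. x \<in> {a..b} \<Longrightarrow> f' x \<le> k"
  shows "f b - f a \<le> k * (b - a)"
proof -
  have "f b - k * b \<le> f a - k * a"
  proof (rule nonpos_deriv_imp_ge[OF assms(2)])
    fix x assume x: "x \<in> {a..b}"
    show "((\<lambda>x. f x - k * x) has_real_derivative f' x - k) (at x within {a..b})"
      by (auto intro!: derivative_eq_intros has_field_derivative_at_within[OF assms(1)])
    show "f' x - k \<le> 0" using assms(3)[OF x] by simp
  qed
  then show ?thesis by (simp add: algebra_simps)
qed

context branches
begin

text \<open>By \<open>large\<close>, \<open>V L\<close> differs from \<open>vc\<close> by less than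
  each of the three margins. Monotonicity then keeps V in [pp, 1] inside and in [0, pm] outside, so
  clipping is inactive and g(U) = V = K * U everywhere, which is the stationary equation.\<close>

lemma ground_state_solution:
  assumes d: "0 < d" and g: "\<And>u. g u = u - f u / d" and g0: "g 0 = 0"
    and vc: "0 < vc" "vc < 1"
    and hm: "\<And>v. v \<in> {0..pm} \<Longrightarrow> g (hm v) = v"
    and hp: "\<And>v. v \<in> {pp..1} \<Longrightarrow> g (hp v) = v" "\<And>v. 0 < hp v"
    and bal: "potential hp vc - potential hm vc = potential hp 1"
    and large: "exp (- (1 - \<theta>) * L) / \<theta> < (1 - \<theta>) * min vc (min (pm - vc) (vc - pp))"
  obtains V where "ground_state d f (\<lambda>x. H x (V x))" "{x. \<not> isCont (\<lambda>x. H x (V x)) x} = {- L, L}"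
    "\<And>x. \<bar>x\<bar> \<le> L \<Longrightarrow> 1 - H x (V x) \<le> exp (- (1 - \<theta>) * (L - \<bar>x\<bar>))"
proof -
  obtain V where V: "continuous_on UNIV V" "\<And>x. V (- x) = V x" "V = conv kernel (\<lambda>y. H y (V y))"
    using ex_profile by blast
  have "(1 - \<theta>) * \<bar>V L - vc\<bar> < (1 - \<theta>) * min vc (min (pm - vc) (vc - pp))"
    using interface_value[OF V less_imp_le[OF vc(1)] less_imp_le[OF vc(2)] bal] large by linarith
  then have "\<bar>V L - vc\<bar> < min vc (min (pm - vc) (vc - pp))"
    using \<theta> by simp
  then have VL: "0 < V L" "V L \<le> pm" "pp \<le> V L" by linarith+
  have V_pos: "0 < V x" for x
    by (rule V_pos[OF V]) (use VL(1) V_inner[OF V, of 0] L in auto)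
  have inner: "V x \<in> {pp..1}" if "\<bar>x\<bar> \<le> L" for x
    using V_inner[OF V that] VL V_range[OF V, of x] by auto
  have outer: "V x \<in> {0..pm}" if "\<not> \<bar>x\<bar> \<le> L" for x
    using V_outer[OF V, of x] that VL V_range[OF V, of x] by auto
  have gU: "g (H x (V x)) = V x" for x
    using hm[OF outer] hp(1)[OF inner] by (simp add: H_def)
  have U_pos: "0 < H x (V x)" for x
  proof (cases "\<bar>x\<bar> \<le> L")
    case True
    then show ?thesis using hp(2) by (simp add: H_def)
  next
    case False
    have "H x (V x) \<noteq> 0" using gU[of x] V_pos[of x] g0 by auto
    then show ?thesis using H_range(1)[of x "V x"] by linarith
  qed
  have "0 = d * (- H x (V x) + conv kernel (\<lambda>y. H y (V y)) x) + f (H x (V x))" for x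
    using gU[of x] d fun_cong[OF V(3), of x] by (simp add: g field_simps)
  then have "ground_state d f (\<lambda>x. H x (V x))"
    unfolding ground_state_def
    using U_even[OF V] H_lebesgue[OF V(1)] U_square_integrable[OF V] U_tendsto_0[OF V] U_pos
      H_range by (auto intro!: boundedI[of _ 1])
  then show thesis
    using that[of V] U_discontinuities[OF V] U_core[OF V] by blast
qed

end

section \<open>Choice of the constants and of the jump position\<close>

theorem proposition4p3:
  fixes f g :: "real \<Rightarrow> real" and d a \<beta> \<gamma> u_plus u_minus v_c :: real
  assumes d_pos: "d > 0"
    and f_smooth: "smooth f"
    and a: "0 < a" "a < 1"
    and f_zeros: "f 0 = 0" "f a = 0" "f 1 = 0"
    and f_neg: "\<forall>u\<in>{0<..<a}. f u < 0"
    and f_pos: "\<forall>u\<in>{a<..<1}. f u > 0"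
    and f_deriv: "deriv f 0 < 0" "deriv f 1 < 0" "deriv f a > 0"
    and f_integral: "integral {0..1} f > 0"
    and g_def: "g = (\<lambda>u. u - f u / d)"
    and beta_gamma: "0 < \<beta>" "\<beta> < \<gamma>" "\<gamma> < 1"
    and g_incr: "\<forall>u\<in>{0..<\<beta>} \<union> {\<gamma><..1}. deriv g u > 0"
    and g_decr: "\<forall>u\<in>{\<beta><..<\<gamma>}. deriv g u < 0"
    and g_crit: "deriv g \<beta> = 0" "deriv g \<gamma> = 0"
    and G_neg: "G_minus g \<beta> (g \<beta>) < 0"
    and G_ineq: "- G_minus g \<beta> (g \<beta>) \<ge> G_plus g \<gamma> 1 - G_plus g \<gamma> (g \<beta>)"
    and v_c_mem: "v_c \<in> {0<..g \<beta>} \<inter> {g \<gamma>..<1}"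
    and v_c_eq: "G_plus g \<gamma> v_c - G_minus g \<beta> v_c = G_plus g \<gamma> 1"
    and u_plus: "\<gamma> < u_plus" "u_plus < 1" "deriv f u_plus = 0"
      "\<forall>u\<in>{u_plus<..1}. deriv f u < 0"
    and u_minus: "0 < u_minus" "u_minus < \<beta>" "deriv f u_minus = 0"
      "\<forall>u\<in>{0..<u_minus}. deriv f u < 0"
    and v_c_between: "g u_plus < v_c" "v_c < g u_minus"
  shows "\<forall>l>0. \<forall>u. cauchy_solution d f l u \<longrightarrow>
    (\<exists>U x\<^sub>0. ground_state d f U \<and> {x. \<not> isCont U x} = {- x\<^sub>0, x\<^sub>0} \<and> x\<^sub>0 \<ge> l \<and>
       limsup_le_uniformly u U (UNIV - {- x\<^sub>0, x\<^sub>0}))"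
proof -
  note fd = smooth_derivs(1)[OF f_smooth] and f'_cont = smooth_derivs(2)[OF f_smooth]
  have gd: "(g has_real_derivative 1 - deriv f x / d) (at x)" for x
    using d_pos unfolding g_def by (auto intro!: derivative_eq_intros fd)
  have g_deriv: "deriv g x = 1 - deriv f x / d" for x by (rule DERIV_imp_deriv[OF gd])
  have g_cont: "continuous_on A g" for A
    using gd by (intro DERIV_continuous_on) (auto intro: has_field_derivative_at_within)
  have g01: "g 0 = 0" "g 1 = 1" by (simp_all add: g_def f_zeros)
  have vc: "0 < v_c" "v_c < 1" using v_c_mem by auto
  have inj: "inj_on g {0..\<beta>}" "inj_on g {\<gamma>..1}"
  proof -
    have less: "g x < g y" if "x < y" and p: "\<And>z. x < z \<Longrightarrow> z < y \<Longrightarrow> 0 < deriv g z" for x y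
      by (rule DERIV_pos_imp_increasing_open[OF \<open>x < y\<close> _ g_cont])
        (use gd g_deriv p in metis)
    show "inj_on g {0..\<beta>}"
      by (rule linorder_inj_onI') (use less g_incr in \<open>force\<close>)
    show "inj_on g {\<gamma>..1}"
      by (rule linorder_inj_onI') (use less g_incr in \<open>force\<close>)
  qed

  \<comment> \<open>\<open>xm\<close> and \<open>xp\<close> are the two outer preimages of
    \<open>v_c\<close>, the values of U on either side of the limiting jump.\<close>
  obtain xm where xm: "0 \<le> xm" "xm \<le> u_minus" "g xm = v_c"
    using IVT'[of g 0 v_c u_minus] g_cont g01 vc v_c_between u_minus by auto
  obtain xp where xp: "u_plus \<le> xp" "xp \<le> 1" "g xp = v_c"
    using IVT'[of g u_plus v_c 1] g_cont g01 vc v_c_between u_plus by auto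
  have xm_less: "xm < u_minus" and xp_less: "u_plus < xp" "xp < 1"
    using xm xp v_c_between vc g01 by (auto simp: less_le)
  \<comment> \<open>Midpoints leave room on both sides: \<open>g c < v_c < g b\<close> for the
    clipping, and a distance from the zeros \<open>u_minus\<close> and \<open>u_plus\<close> of
    f'.\<close>
  define b c where "b = (xm + u_minus) / 2" and "c = (u_plus + xp) / 2"
  have b: "xm < b" "b < u_minus" and c: "u_plus < c" "c < xp"
    using xm_less xp_less by (auto simp: b_def c_def)

  have "\<forall>\<^sub>F x in at 1. deriv f x < 0"
    using f'_cont f_deriv(2) by (intro order_tendstoD) (auto simp: continuous_on_eq_continuous_at isCont_def)
  then obtain \<rho>1 where \<rho>1: "0 < \<rho>1" "\<And>x. x \<noteq> 1 \<Longrightarrow> dist x 1 < \<rho>1 \<Longrightarrow> deriv f x < 0"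
    by (auto simp: eventually_at)
  \<comment> \<open>The supersolution exceeds U by up to \<open>\<rho>\<close>, so f' must stay
    negative slightly beyond \<open>b\<close> and slightly beyond 1; the latter rests on continuity
    of f' at 1.\<close>
  define \<rho> where "\<rho> = min (u_minus - b) \<rho>1 / 2"
  have \<rho>: "0 < \<rho>" "b + \<rho> < u_minus" "\<rho> < \<rho>1" using b \<rho>1(1) by (simp_all add: \<rho>_def min_def field_simps)
  obtain \<delta> where \<delta>: "0 < \<delta>" "\<And>x. x \<in> {0..b + \<rho>} \<union> {c..1 + \<rho>} \<Longrightarrow> deriv f x \<le> - \<delta>"
  proof (rule negative_on_compact)
    show "deriv f x < 0" if "x \<in> {0..b + \<rho>} \<union> {c..1 + \<rho>}" for x
      using that u_minus(4) u_plus(4) c \<rho> \<rho>1(2)[of x] by (cases "x \<le> 1") (auto simp: dist_real_def)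
  qed (auto intro: continuous_on_subset[OF f'_cont])

  \<comment> \<open>f' \<le> -\<delta> means g' = 1 - f'/d \<ge> 1 + \<delta>/d, and this lower
    bound is \<open>1 / \<theta>\<close>.\<close>
  define \<theta> where "\<theta> = d / (d + \<delta>)"
  have \<theta>: "0 < \<theta>" "\<theta> < 1" using d_pos \<delta>(1) by (auto simp: \<theta>_def)
  have expand: "y - x \<le> \<theta> * (g y - g x)" if "x \<le> y" "{x..y} \<subseteq> {0..b + \<rho>} \<union> {c..1 + \<rho>}" for x y
  proof -
    have "f y - f x \<le> - \<delta> * (y - x)"
      using that by (intro deriv_bound_imp_le[OF fd] \<delta>(2)) auto
    then have "(d + \<delta>) * (y - x) \<le> d * (g y - g x)"
      using d_pos by (simp add: g_def algebra_simps)
    then show ?thesis using d_pos \<delta>(1) by (simp add: \<theta>_def field_simps)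
  qed
  have stable: "f (v + s) \<le> f v - \<delta> * s" if "v \<in> {0..b} \<union> {c..1}" "0 \<le> s" "s \<le> \<rho>" for v s
  proof -
    have "f (v + s) - f v \<le> - \<delta> * (v + s - v)"
      using that by (intro deriv_bound_imp_le[OF fd] \<delta>(2)) auto
    then show ?thesis by simp
  qed

  define hm hp where "hm v = inv_into {0..\<beta>} g (max (g 0) (min (g b) v))"
    and "hp v = inv_into {\<gamma>..1} g (max (g c) (min (g 1) v))" for v
  have b0: "0 \<le> b" "{0..b} \<subseteq> {0..\<beta>}" "c \<le> 1" "{c..1} \<subseteq> {\<gamma>..1}"
    using b c xm xp u_minus u_plus by auto
  have hm_expand: "y - x \<le> \<theta> * (g y - g x)" if "x \<in> {0..b}" "y \<in> {0..b}" "x \<le> y" for x y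
    using that \<rho> by (intro expand) auto
  have hp_expand: "y - x \<le> \<theta> * (g y - g x)" if "x \<in> {c..1}" "y \<in> {c..1}" "x \<le> y" for x y
    using that \<rho> by (intro expand) auto
  note hm = clipped_inverse[OF b0(1,2) inj(1) g_cont \<theta>(1) hm_expand, folded hm_def]
  note hp = clipped_inverse[OF b0(3,4) inj(2) g_cont \<theta>(1) hp_expand, folded hp_def]
  have b1: "b < 1" and c0: "0 < c" using b c u_minus u_plus beta_gamma by auto
  have gb: "v_c < g b"
  proof -
    have "b - xm \<le> \<theta> * (g b - g xm)" using b xm by (intro hm_expand) auto
    then have "0 < \<theta> * (g b - v_c)" using b xm by simp
    then show ?thesis using \<theta> by (simp add: zero_less_mult_iff)
  qed
  have gc: "g c < v_c"
  proof -
    have "xp - c \<le> \<theta> * (g xp - g c)" using c xp by (intro hp_expand) auto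
    then have "0 < \<theta> * (v_c - g c)" using c xp by simp
    then show ?thesis using \<theta> by (simp add: zero_less_mult_iff)
  qed
  have branches: "branches \<theta> L hm hp" if "0 < L" for L
  proof
    show "0 \<le> hm v" "hm v \<le> 1" for v using hm(1)[of v] b1 by auto
    show "0 \<le> hp v" "hp v \<le> 1" for v using hp(1)[of v] c0 by auto
    show "hm 0 = 0" using hm(3)[of 0] b0 g01 by simp
    show "hp 1 = 1" using hp(3)[of 1] b0 g01 by simp
  qed (use \<theta> that hm(4) hp(4) in auto)
  have bal: "potential hp v_c - potential hm v_c = potential hp 1"
  proof (rule balance_condition[OF _ _ _ _ _ _ v_c_eq])
    show "hm w = inv_into {0..\<beta>} g w" if "w \<in> {0..v_c}" for w
      using that gb g01 by (intro hm(5)) auto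
    show "hp w = inv_into {\<gamma>..1} g w" if "w \<in> {v_c..1}" for w
      using that gc g01 by (intro hp(5)) auto
  qed (use vc branches.hm_cont[OF branches[OF zero_less_one]] branches.hp_cont[OF branches[OF zero_less_one]] in auto)

  show ?thesis
  proof (intro allI impI)
    fix l :: real and u assume l: "0 < l" and sol: "cauchy_solution d f l u"
    define \<eta> where "\<eta> = (1 - \<theta>) * min v_c (min (g b - v_c) (v_c - g c))"
    have \<eta>: "0 < \<eta>" using \<theta> vc gb gc by (simp add: \<eta>_def)
    have "((\<lambda>L. exp (- (1 - \<theta>) * (L - l))) \<longlongrightarrow> 0) at_top" "((\<lambda>L. exp (- (1 - \<theta>) * L) / \<theta>) \<longlongrightarrow> 0) at_top"
      using \<theta> by real_asymp+
    then have "\<forall>\<^sub>F L in at_top. exp (- (1 - \<theta>) * (L - l)) < \<rho>" "\<forall>\<^sub>F L in at_top. exp (- (1 - \<theta>) * L) / \<theta> < \<eta>"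
      using \<rho>(1) \<eta> by (auto dest: order_tendstoD)
    then have "\<forall>\<^sub>F L in at_top. l \<le> L \<and> exp (- (1 - \<theta>) * (L - l)) < \<rho> \<and> exp (- (1 - \<theta>) * L) / \<theta> < \<eta>"
      using eventually_ge_at_top[of l] by eventually_elim simp
    \<comment> \<open>The three demands place the jump at or beyond \<open>l\<close>, make the core
      defect of U on [-l, l] smaller than \<open>\<rho>\<close>, and bring the interface value
      within the margins around \<open>v_c\<close>.\<close>
    then obtain L where L: "l \<le> L" "exp (- (1 - \<theta>) * (L - l)) < \<rho>" "exp (- (1 - \<theta>) * L) / \<theta> < \<eta>"
      by (auto dest: eventually_happens)
    interpret br: branches \<theta> L hm hp using l L(1) by (intro branches) auto
    obtain V where gs: "ground_state d f (\<lambda>x. br.H x (V x))"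
      and disc: "{x. \<not> isCont (\<lambda>x. br.H x (V x)) x} = {- L, L}"
      and core: "\<And>x. \<bar>x\<bar> \<le> L \<Longrightarrow> 1 - br.H x (V x) \<le> exp (- (1 - \<theta>) * (L - \<bar>x\<bar>))"
    proof (rule br.ground_state_solution[where d = d and f = f and g = g and vc = v_c and pm = "g b" and pp = "g c"])
      show "g (hm v) = v" if "v \<in> {0..g b}" for v using hm(2) that g01 by simp
      show "g (hp v) = v" if "v \<in> {g c..1}" for v using hp(2) that g01 by simp
      show "0 < hp v" for v using hp(1)[of v] c0 by simp
      show "exp (- (1 - \<theta>) * L) / \<theta> < (1 - \<theta>) * min v_c (min (g b - v_c) (v_c - g c))"
        using L(3) by (simp add: \<eta>_def)
    qed (use d_pos g01 vc bal in \<open>auto simp: g_def\<close>)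
    define U where "U = (\<lambda>x. br.H x (V x))"
    define q where "q = exp (- (1 - \<theta>) * (L - l))"
    have U_range: "U x \<in> {0..b} \<union> {c..1}" for x
      using hm(1)[of "V x"] hp(1)[of "V x"] by (auto simp: U_def br.H_def)
    interpret super: supersolution d q \<delta> l 1 f "deriv f" U u
    proof
      show "U \<in> borel_measurable lebesgue" and "0 = d * (- U x + conv kernel U x) + f (U x)" for x
        using gs by (simp_all add: ground_state_def U_def)
      show "\<bar>U x\<bar> \<le> 1" for x using br.H_range[of x "V x"] by (simp add: U_def)
      show "f (U x + s) \<le> f (U x) - \<delta> * s" if "0 \<le> s" "s \<le> q" for x s
        using that L(2) U_range by (intro stable) (auto simp: q_def)
      show "indicator {- l..l} x \<le> U x + q" for x
      proof (cases "\<bar>x\<bar> \<le> l")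
        case True
        have "1 - U x \<le> exp (- (1 - \<theta>) * (L - \<bar>x\<bar>))"
          using core[of x] True L(1) by (simp add: U_def)
        also have "\<dots> \<le> q"
          using True \<theta> by (simp add: q_def mult_left_mono)
        finally show ?thesis by (simp add: indicator_def)
      next
        case False
        then have "x \<notin> {- l..l}" by auto
        then show ?thesis using br.H_range(1)[of x "V x"] by (simp add: U_def q_def add_nonneg_nonneg)
      qed
    qed (use d_pos \<delta>(1) fd f'_cont sol in \<open>auto simp: q_def\<close>)
    have "limsup_le_uniformly u U A" for A
      unfolding limsup_le_uniformly_def
    proof (intro allI impI)
      fix \<epsilon> :: real assume "0 < \<epsilon>"
      have "((\<lambda>t. q * exp (- \<delta> * t)) \<longlongrightarrow> 0) at_top" using \<delta>(1) by real_asymp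
      then have "\<forall>\<^sub>F t in at_top. q * exp (- \<delta> * t) < \<epsilon>" using \<open>0 < \<epsilon>\<close> by (rule order_tendstoD)
      then obtain T where T: "\<And>t. T \<le> t \<Longrightarrow> q * exp (- \<delta> * t) < \<epsilon>"
        by (auto simp: eventually_at_top_linorder)
      show "\<exists>T>0. \<forall>t\<ge>T. \<forall>x\<in>A. u t x \<le> U x + \<epsilon>"
      proof (intro exI[of _ "max T 1"] conjI allI impI ballI)
        fix t x assume "max T 1 \<le> t"
        then show "u t x \<le> U x + \<epsilon>" using super.comparison[of t x] T[of t] by auto
      qed simp
    qed
    then show "\<exists>U x\<^sub>0. ground_state d f U \<and> {x. \<not> isCont U x} = {- x\<^sub>0, x\<^sub>0} \<and> x\<^sub>0 \<ge> l \<and>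
       limsup_le_uniformly u U (UNIV - {- x\<^sub>0, x\<^sub>0})"
      using gs disc L(1) unfolding U_def by blast
  qed
qed

end
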